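(* Let $r\ge1$, $q=2r$ and $d\ge2q$ be integers, let $\sigma\ge0$, and let $U_{s,1},U_{s,2}\in\mathbb{R}^{d\times r}$ have orthonormal columns with $U_{s,1}^\top U_{s,2}=0$. For $\epsilon>0$ and prompt length $n$, let $g^\star_{\mathcal W}$ be the optimal linear attention model (see context) for training prompts of length $n$ whose task vector is drawn from the mixture $$w\sim\tfrac12\mathcal N(0,\Sigma_{s,1})+\tfrac12\mathcal N(0,\Sigma_{s,2}),\qquad \Sigma_{s,k}=U_{s,k}U_{s,k}^\top+\epsilon I_d .$$ Let $U_s\in\mathbb{R}^{d\times q}$ be an orthonormal basis of $\mathrm{span}(U_{s,1})+\mathrm{span}(U_{s,2})$, let $U_{s,\perp}\in\mathbb{R}^{d\times q}$ be any matrix with orthonormal columns satisfying $U_s^\top U_{s,\perp}=0$, let $\theta\in[0,\pi/2]$, and let $$U_t=\cos(\theta)\,U_s+\sin(\theta)\,U_{s,\perp}\in\mathbb{R}^{d\times q}.$$ Let test prompts $\widetilde Z$ of length $m$, with query label $\widetilde y_{m+1}$, be generated with test task vector $\widetilde w\sim\mathcal N(0,\Sigma_t)$, $\Sigma_t=U_tU_t^\top+\epsilon I_d$. Then $$\lim_{m\to\infty}\lim_{n\to\infty}\lim_{\epsilon\to0}\mathbb E\Big[\big(\widetilde y_{m+1}-g^\star_{\mathcal W}(\widetilde Z)\big)^2\Big]=q\sin^2(\theta)+\sigma^2 .$$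
   Context: Training data: $x_1,\dots,x_{n+1}\sim\mathcal N(0,I_d)$ independent, task vector $w\in\mathbb{R}^d$ (shared by the whole prompt) independent of the $x_i$, noise $\xi_i\sim\mathcal N(0,\sigma^2)$ independent of everything else, and $y_i=w^\top x_i+\xi_i$ for $i\in\{1,\dots,n+1\}$. Prompt: $Z\in\mathbb{R}^{(n+1)\times(d+1)}$ with rows $z_i^\top=(x_i^\top,y_i)$ for $i\le n$ and $z_{n+1}^\top=(x_{n+1}^\top,0)$; masked prompt $Z_{\mathcal M}$ is $Z$ with its last row replaced by zero. Linear attention with weights $\mathcal W=\{W_Q,W_K,W_V\}$, each in $\mathbb{R}^{(d+1)\times(d+1)}$, and $p=(0_d^\top,1)^\top$: $$g_{\mathcal W}(Z)=\frac1n\big(z_{n+1}^\top W_QW_K^\top Z_{\mathcal M}^\top\big)Z_{\mathcal M}W_Vp .$$ The optimal model $g^\star_{\mathcal W}$ uses weights $\mathcal W^\star$ minimizing the training loss $\mathcal L(\mathcal W)=\mathbb E[(y_{n+1}-g_{\mathcal W}(Z))^2]$ (so it depends on $n$ and $\epsilon$). Test data: $x_1,\dots,x_{m+1}\sim\mathcal N(0,I_d)$ independent, $\widetilde w$ independent of them, $\widetilde y_j=\widetilde w^\top x_j+\xi_j$ with $\xi_j\sim\mathcal N(0,\sigma^2)$ independent, $j\in\{1,\dots,m+1\}$, all independent of the training data. The test prompt $\widetilde Z\in\mathbb{R}^{(m+1)\times(d+1)}$ has rows $(x_j^\top,\widetilde y_j)$ for $j\le m$ and last row $\widetilde z_{m+1}^\top=(x_{m+1}^\top,0)$;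 with $\widetilde Z_{\mathcal M}$ its masked version, the test prediction is $$g^\star_{\mathcal W}(\widetilde Z)=\frac1m\big(\widetilde z_{m+1}^\top W_Q^\star W_K^{\star\top}\widetilde Z_{\mathcal M}^\top\big)\widetilde Z_{\mathcal M}W_V^\star p ,$$ normalized by $m$ instead of $n$. The expectation in the test risk is over all test randomness. *)

theory Defs
  imports "HOL-Probability.Probability"
begin

section \<open>Gaussian laws\<close>

text \<open>The law of \<open>\<sigma> z\<close> with \<open>z\<close> standard normal; unlike \<open>normal_density 0 \<sigma>\<close> this also covers
  the degenerate case \<open>\<sigma> = 0\<close>.\<close>
definition normal_noise :: "real \<Rightarrow> real measure" where
  "normal_noise \<sigma> = distr std_normal_distribution borel (\<lambda>z. \<sigma> * z)"

definition std_normal_vec :: "(real ^ 'd) measure" where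
  "std_normal_vec = distr (\<Pi>\<^sub>M i\<in>UNIV. std_normal_distribution) borel (\<lambda>z. \<chi> i. z i)"

definition is_psd_root :: "real ^ 'd ^ 'd \<Rightarrow> real ^ 'd ^ 'd \<Rightarrow> bool" where
  "is_psd_root S R \<longleftrightarrow> transpose R = R \<and> (\<forall>v. 0 \<le> v \<bullet> (R *v v)) \<and> R ** R = S"

text \<open>The positive semidefinite square root; it exists and is unique for every symmetric positive
  semidefinite matrix, and is only meaningful there.\<close>
definition psd_root :: "real ^ 'd ^ 'd \<Rightarrow> real ^ 'd ^ 'd" where
  "psd_root S = (SOME R. is_psd_root S R)"

text \<open>\<open>N(0, \<Sigma>)\<close>, as the law of \<open>\<Sigma>\<^sup>1\<^sup>/\<^sup>2 z\<close> with \<open>z\<close> distributed as \<open>N(0, I)\<close>.\<close>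
definition normal_vec :: "real ^ 'd ^ 'd \<Rightarrow> (real ^ 'd) measure" where
  "normal_vec S = distr std_normal_vec borel (\<lambda>z. psd_root S *v z)"


section \<open>Task laws\<close>

definition orthonormal_columns :: "real ^ 'k ^ 'd \<Rightarrow> bool" where
  "orthonormal_columns U \<longleftrightarrow> transpose U ** U = mat 1"

definition task_cov :: "real \<Rightarrow> real ^ 'k ^ 'd \<Rightarrow> real ^ 'd ^ 'd" where
  "task_cov \<epsilon> U = U ** transpose U + \<epsilon> *\<^sub>R mat 1"

lemma is_psd_root_task_cov:
  fixes U :: "real ^ 'k ^ 'd"
  assumes U: "orthonormal_columns U" and \<epsilon>: "0 \<le> \<epsilon>"
  shows "is_psd_root (task_cov \<epsilon> U) (psd_root (task_cov \<epsilon> U))"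
proof -
  define P where "P = U ** transpose U"
  define a where "a = sqrt \<epsilon>"
  define b where "b = sqrt (1 + \<epsilon>) - sqrt \<epsilon>"
  define R where "R = a *\<^sub>R mat 1 + b *\<^sub>R P"
  have PP: "P ** P = P"
  proof -
    have "P ** P = U ** (transpose U ** U) ** transpose U"
      unfolding P_def by (simp add: matrix_mul_assoc)
    then show ?thesis
      using U by (simp add: orthonormal_columns_def P_def)
  qed
  have ab: "0 \<le> a" "0 \<le> b" "a * a = \<epsilon>" "2 * a * b + b * b = 1"
    using \<epsilon> by (auto simp: a_def b_def algebra_simps)
  have tP: "transpose P = P"
    by (simp add: P_def matrix_transpose_mul)
  have tR: "transpose R = R"
    using tP by (simp add: R_def transpose_def vec_eq_iff mat_def)
  have Rv: "R *v v = a *\<^sub>R v + b *\<^sub>R (P *v v)" for v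
    by (simp add: R_def matrix_vector_mult_add_rdistrib flip: scaleR_matrix_vector_assoc)
  have quad: "0 \<le> v \<bullet> (R *v v)" for v
  proof -
    have "v \<bullet> (P *v v) = (transpose U *v v) \<bullet> (transpose U *v v)"
      by (simp add: P_def dot_lmul_matrix flip: matrix_vector_mul_assoc)
    then show ?thesis
      using ab by (simp add: Rv inner_add_right)
  qed
  have "(R ** R) *v v = task_cov \<epsilon> U *v v" for v
  proof -
    have "P *v (P *v v) = P *v v"
      by (simp add: matrix_vector_mul_assoc PP)
    then have "(R ** R) *v v =
        a *\<^sub>R (a *\<^sub>R v + b *\<^sub>R (P *v v)) + b *\<^sub>R (a *\<^sub>R (P *v v) + b *\<^sub>R (P *v v))"
      by (simp add: Rv matrix_vector_right_distrib matrix_vector_mult_scaleR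
          flip: matrix_vector_mul_assoc)
    also have "\<dots> = (a * a) *\<^sub>R v + (2 * a * b + b * b) *\<^sub>R (P *v v)"
      by (simp add: vec_eq_iff algebra_simps)
    also have "\<dots> = task_cov \<epsilon> U *v v"
      by (simp add: ab task_cov_def P_def matrix_vector_mult_add_rdistrib
          flip: scaleR_matrix_vector_assoc)
    finally show ?thesis .
  qed
  then have "R ** R = task_cov \<epsilon> U"
    by (simp add: matrix_eq)
  then have "is_psd_root (task_cov \<epsilon> U) R"
    using tR quad by (simp add: is_psd_root_def)
  then show ?thesis
    unfolding psd_root_def by (rule someI)
qed

definition mixture_task_law ::
  "real \<Rightarrow> real ^ 'k ^ 'd \<Rightarrow> real ^ 'k ^ 'd \<Rightarrow> (real ^ 'd) measure" where
  "mixture_task_law \<epsilon> U1 U2 =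
     measure_pmf (bernoulli_pmf (1/2)) \<bind>
       (\<lambda>b. normal_vec (task_cov \<epsilon> (if b then U1 else U2)))"


section \<open>Prompts and linear attention\<close>

text \<open>The index type \<open>'d option\<close> has \<open>d + 1\<close> elements: \<open>Some i\<close> is the \<open>i\<close>-th feature
  coordinate, \<open>None\<close> is the last (label) coordinate. A prompt of length \<open>k\<close> is the matrix with rows
  \<open>Z 1, \<dots>, Z (k + 1)\<close>; values of \<open>Z\<close> outside \<open>{1..k + 1}\<close> are irrelevant.\<close>
type_synonym 'd weights =
  "(real ^ 'd option ^ 'd option) \<times> (real ^ 'd option ^ 'd option) \<times> (real ^ 'd option ^ 'd option)"

definition prompt ::
  "nat \<Rightarrow> (nat \<Rightarrow> real ^ 'd) \<Rightarrow> (nat \<Rightarrow> real) \<Rightarrow> nat \<Rightarrow> real ^ 'd option" where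
  "prompt k x y i =
     (\<chi> j. case j of Some a \<Rightarrow> x i $ a | None \<Rightarrow> (if i = k + 1 then 0 else y i))"

definition masked :: "nat \<Rightarrow> (nat \<Rightarrow> real ^ ('d::finite) option) \<Rightarrow> nat \<Rightarrow> real ^ 'd option" where
  "masked k Z i = (if i = k + 1 then 0 else Z i)"

text \<open>The sum is the product of the row vector \<open>z\<^sup>T W\<^sub>Q W\<^sub>K\<^sup>T Z\<^sub>M\<^sup>T\<close>, where \<open>z\<close> is the last row of
  \<open>Z\<close>, with the column vector \<open>Z\<^sub>M W\<^sub>V p\<close>; here \<open>p = axis None 1\<close>.\<close>
definition linear_attention :: "('d::finite) weights \<Rightarrow> nat \<Rightarrow> (nat \<Rightarrow> real ^ 'd option) \<Rightarrow> real" where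
  "linear_attention W k Z =
     (case W of (WQ, WK, WV) \<Rightarrow>
        1 / real k *
        (\<Sum>i = 1..k + 1. ((Z (k + 1) v* (WQ ** transpose WK)) \<bullet> masked k Z i) *
                       (masked k Z i \<bullet> (WV *v axis None 1))))"


section \<open>Prediction risk\<close>

text \<open>Joint law of the features \<open>x\<^sub>1, \<dots>, x\<^sub>k\<^sub>+\<^sub>1\<close>, the task vector and the noises
  \<open>\<xi>\<^sub>1, \<dots>, \<xi>\<^sub>k\<^sub>+\<^sub>1\<close>, all independent.\<close>
definition data_law ::
  "real \<Rightarrow> (real ^ 'd) measure \<Rightarrow> nat \<Rightarrow>
    ((nat \<Rightarrow> real ^ 'd) \<times> (real ^ 'd) \<times> (nat \<Rightarrow> real)) measure" where
  "data_law \<sigma> T k =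
     (\<Pi>\<^sub>M i\<in>{1..k + 1}. std_normal_vec) \<Otimes>\<^sub>M (T \<Otimes>\<^sub>M (\<Pi>\<^sub>M i\<in>{1..k + 1}. normal_noise \<sigma>))"

definition label ::
  "(nat \<Rightarrow> real ^ 'd) \<Rightarrow> real ^ 'd \<Rightarrow> (nat \<Rightarrow> real) \<Rightarrow> nat \<Rightarrow> real" where
  "label x w \<xi> i = w \<bullet> x i + \<xi> i"

definition risk :: "real \<Rightarrow> (real ^ 'd) measure \<Rightarrow> nat \<Rightarrow> 'd weights \<Rightarrow> real" where
  "risk \<sigma> T k W =
     (\<integral>(x, w, \<xi>). (label x w \<xi> (k + 1)
                  - linear_attention W k (prompt k x (label x w \<xi>)))\<^sup>2 \<partial>data_law \<sigma> T k)"

definition optimal_weights :: "real \<Rightarrow> (real ^ 'd) measure \<Rightarrow> nat \<Rightarrow> 'd weights \<Rightarrow> bool" where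
  "optimal_weights \<sigma> T n W \<longleftrightarrow> (\<forall>W'. risk \<sigma> T n W \<le> risk \<sigma> T n W')"

end

theory Submission
  imports Defs
begin

text \<open>With \<open>W\<^sub>Q W\<^sub>K\<^sup>T\<close> and \<open>W\<^sub>V p\<close> in block form, the prediction is \<open>x \<bullet> g\<close> for the query \<open>x\<close>, where
  \<open>g = M h + r\<close>, \<open>h = (1/k) \<Sum> y\<^sub>i x\<^sub>i\<close> is odd and \<open>r\<close> is even under \<open>(w, \<xi>) \<mapsto> (-w, -\<xi>)\<close>. The law of the data is
  invariant under this flip, so the risk splits into the risk of \<open>M h\<close> and \<open>E (x \<bullet> r)\<^sup>2\<close>. Since \<open>r = 0\<close> can be
  attained with any \<open>M\<close>, at an optimum \<open>r = 0\<close> almost surely, and testing this against suitable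
  polynomials shows that \<open>r\<close> vanishes identically, hence also on test prompts. The optimal \<open>M\<close> is the unique solution
  of the normal equations: it is a combination of the projection \<open>P\<close> onto the span of the task subspaces and of
  \<open>I - P\<close>, whose coefficients tend to \<open>1\<close> and \<open>0\<close>. In the limit the error is the part of the test task vector
  outside the range of \<open>P\<close>, whose energy is \<open>q sin\<^sup>2 \<theta>\<close>.\<close>

text \<open>The weights enter the prediction through products, so minimizers are far from unique and
  nothing can be said about \<open>W\<close> itself. Everything is proved for an arbitrary minimizer
  through \<open>effective_matrix\<close> and the even part. Training fixes one prompt length and
  one task law while the test uses others, which is why vanishing of r almost surely has to be
  upgraded to an identity between blocks of the weights. Once the features are integrated out, the
  squared residual of M h is quadratic in (w, \<xi>), so a task law enters only through its second
  moment S; for the mixture this is P / 2 + \<epsilon> I. An eigenvalue s of S receives the gain n s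
  / ((n + 1) s + \<tau>), where \<tau> = trace S + \<sigma>^2 comes from the sampling error of h.
  The order of the limits matters: at fixed n the gain on the complement of P tends to 0 with
  \<epsilon>, because \<tau> stays at least q / 2, whereas at fixed \<epsilon> it would tend to 1 as
  n grows, and the missing part of the task vector would be recovered.\<close>

section \<open>Random variables with moments of all orders\<close>

text \<open>The random variables with all moments form an algebra. Integrability of any polynomial
  in features, task vector and noise thus follows by structural rules, with no independence argument
  at each product.\<close>

definition has_all_moments :: "'a measure \<Rightarrow> ('a \<Rightarrow> real) \<Rightarrow> bool" where
  "has_all_moments M f \<longleftrightarrow> f \<in> borel_measurable M \<and> (\<forall>p. integrable M (\<lambda>x. f x ^ p))"

lemma has_all_moments_measurable [measurable_dest]: "has_all_moments M f \<Longrightarrow> f \<in> borel_measurable M"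
  by (simp add: has_all_moments_def)

lemma has_all_moments_integrable_power: "has_all_moments M f \<Longrightarrow> integrable M (\<lambda>x. f x ^ p)"
  by (simp add: has_all_moments_def)

lemma has_all_moments_integrable: "has_all_moments M f \<Longrightarrow> integrable M f"
  using has_all_moments_integrable_power[of M f 1] by simp

lemma has_all_moments_const: "prob_space M \<Longrightarrow> has_all_moments M (\<lambda>_. c)"
  by (simp add: has_all_moments_def finite_measure.integrable_const prob_space.finite_measure)

lemma has_all_moments_add:
  assumes f: "has_all_moments M f" and g: "has_all_moments M g"
  shows "has_all_moments M (\<lambda>x. f x + g x)"
  unfolding has_all_moments_def
proof (intro conjI allI)
  show "(\<lambda>x. f x + g x) \<in> borel_measurable M"
    using f g by measurable
  fix p
  show "integrable M (\<lambda>x. (f x + g x) ^ p)"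
  proof (rule Bochner_Integration.integrable_bound)
    show "integrable M (\<lambda>x. 2 ^ p * (\<bar>f x ^ p\<bar> + \<bar>g x ^ p\<bar>))"
      using has_all_moments_integrable_power[OF f] has_all_moments_integrable_power[OF g] by simp
    show "(\<lambda>x. (f x + g x) ^ p) \<in> borel_measurable M"
      using f g by measurable
    have "\<bar>a + b\<bar> ^ p \<le> 2 ^ p * (\<bar>a\<bar> ^ p + \<bar>b\<bar> ^ p)" for a b :: real
    proof -
      have "\<bar>a + b\<bar> ^ p \<le> (2 * max \<bar>a\<bar> \<bar>b\<bar>) ^ p"
        by (intro power_mono) auto
      also have "\<dots> \<le> 2 ^ p * (\<bar>a\<bar> ^ p + \<bar>b\<bar> ^ p)"
        by (simp add: power_mult_distrib max_def)
      finally show ?thesis .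
    qed
    then show "AE x in M. norm ((f x + g x) ^ p) \<le> norm (2 ^ p * (\<bar>f x ^ p\<bar> + \<bar>g x ^ p\<bar>))"
      by (simp add: power_abs)
  qed
qed

text \<open>By the arithmetic-geometric mean inequality a product is dominated by even moments of
  its factors, so the factors may be dependent.\<close>

lemma has_all_moments_mult:
  assumes f: "has_all_moments M f" and g: "has_all_moments M g"
  shows "has_all_moments M (\<lambda>x. f x * g x)"
  unfolding has_all_moments_def
proof (intro conjI allI)
  show "(\<lambda>x. f x * g x) \<in> borel_measurable M"
    using f g by measurable
  fix p
  show "integrable M (\<lambda>x. (f x * g x) ^ p)"
  proof (rule Bochner_Integration.integrable_bound)
    show "integrable M (\<lambda>x. f x ^ (2 * p) + g x ^ (2 * p))"
      using has_all_moments_integrable_power[OF f] has_all_moments_integrable_power[OF g] by simp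
    show "(\<lambda>x. (f x * g x) ^ p) \<in> borel_measurable M"
      using f g by measurable
    have "\<bar>(a * b) ^ p\<bar> \<le> a ^ (2 * p) + b ^ (2 * p)" for a b :: real
    proof -
      have "2 * \<bar>a ^ p * b ^ p\<bar> \<le> (a ^ p)\<^sup>2 + (b ^ p)\<^sup>2"
        using sum_squares_bound[of "\<bar>a ^ p\<bar>" "\<bar>b ^ p\<bar>"] by (simp add: abs_mult)
      moreover have "0 \<le> (a ^ p)\<^sup>2 + (b ^ p)\<^sup>2"
        by simp
      ultimately show ?thesis
        by (simp add: power_mult_distrib mult.commute flip: power_mult)
    qed
    then show "AE x in M. norm ((f x * g x) ^ p) \<le> norm (f x ^ (2 * p) + g x ^ (2 * p))"
      by (intro AE_I2) (smt (verit) real_norm_def)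
  qed
qed

lemma has_all_moments_power:
  assumes "prob_space M" "has_all_moments M f"
  shows "has_all_moments M (\<lambda>x. f x ^ k)"
  using assms by (induction k) (auto intro: has_all_moments_const has_all_moments_mult)

lemma has_all_moments_minus:
  assumes "has_all_moments M f"
  shows "has_all_moments M (\<lambda>x. - f x)"
  using assms by (auto simp: has_all_moments_def power_minus[where a = "f _"])

lemma has_all_moments_diff:
  assumes "has_all_moments M f" "has_all_moments M g"
  shows "has_all_moments M (\<lambda>x. f x - g x)"
  using has_all_moments_add[OF assms(1) has_all_moments_minus[OF assms(2)]] by simp

lemma has_all_moments_sum:
  assumes "prob_space M" "\<And>i. i \<in> I \<Longrightarrow> has_all_moments M (f i)"
  shows "has_all_moments M (\<lambda>x. \<Sum>i\<in>I. f i x)"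
  using assms
  by (induction I rule: infinite_finite_induct)
    (auto intro: has_all_moments_const has_all_moments_add)

lemma has_all_moments_inner:
  fixes f g :: "'a \<Rightarrow> real ^ 'n"
  assumes "prob_space M"
    and "\<And>i. has_all_moments M (\<lambda>x. f x $ i)" "\<And>i. has_all_moments M (\<lambda>x. g x $ i)"
  shows "has_all_moments M (\<lambda>x. f x \<bullet> g x)"
  unfolding inner_vec_def inner_real_def
  using assms by (intro has_all_moments_sum has_all_moments_mult)

lemma has_all_moments_matrix_vector_mult:
  fixes f :: "'a \<Rightarrow> real ^ 'n"
  assumes "prob_space M" "\<And>i. has_all_moments M (\<lambda>x. f x $ i)"
  shows "has_all_moments M (\<lambda>x. (A *v f x) $ i)"
  unfolding matrix_vector_mult_def vec_lambda_beta
  using assms by (intro has_all_moments_sum has_all_moments_mult has_all_moments_const)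

lemma has_all_moments_distr_iff:
  assumes "g \<in> measurable M N" "f \<in> borel_measurable N"
  shows "has_all_moments (distr M N g) f \<longleftrightarrow> has_all_moments M (\<lambda>x. f (g x))"
  using assms by (auto simp: has_all_moments_def integrable_distr_eq)

lemmas has_all_moments_intros =
  has_all_moments_const has_all_moments_add has_all_moments_mult has_all_moments_power
  has_all_moments_minus has_all_moments_diff has_all_moments_sum has_all_moments_inner
  has_all_moments_matrix_vector_mult

section \<open>Coordinates of product measures and second moments of independent sums\<close>

lemma has_all_moments_fst:
  assumes M: "prob_space M" and N: "prob_space N" and f: "has_all_moments M f"
  shows "has_all_moments (M \<Otimes>\<^sub>M N) (\<lambda>z. f (fst z))"
proof -
  have "has_all_moments (distr (M \<Otimes>\<^sub>M N) M fst) f"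
    using f by (simp add: prob_space.distr_pair_fst[OF N])
  then show ?thesis
    using f by (subst (asm) has_all_moments_distr_iff) auto
qed

lemma has_all_moments_snd:
  assumes M: "prob_space M" and N: "prob_space N" and f: "has_all_moments N f"
  shows "has_all_moments (M \<Otimes>\<^sub>M N) (\<lambda>z. f (snd z))"
proof -
  interpret M: prob_space M by fact
  interpret N: prob_space N by fact
  interpret pair_prob_space N M by standard
  have "has_all_moments (distr (N \<Otimes>\<^sub>M M) (M \<Otimes>\<^sub>M N) (\<lambda>(x, y). (y, x))) (\<lambda>z. f (snd z))"
    using has_all_moments_fst[OF N M f] f
    by (subst has_all_moments_distr_iff) (auto simp: case_prod_unfold intro: measurable_compose[OF measurable_snd])
  then show ?thesis
    using pair_sigma_finite.distr_pair_swap[of M N]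
    by (metis pair_sigma_finite.intro M.sigma_finite_measure_axioms N.sigma_finite_measure_axioms)
qed

lemma has_all_moments_PiM:
  assumes "\<And>j. j \<in> I \<Longrightarrow> prob_space (M j)" "i \<in> I" "has_all_moments (M i) f"
  shows "has_all_moments (PiM I M) (\<lambda>z. f (z i))"
proof -
  have "has_all_moments (distr (PiM I M) (M i) (\<lambda>z. z i)) f"
    using assms by (simp add: distr_PiM_component)
  then show ?thesis
    using assms by (subst (asm) has_all_moments_distr_iff) auto
qed

text \<open>By independence only terms with equal index are correlated: the result is the product of
  the means plus the sum of the covariances. The offsets \<open>a\<close> and \<open>b\<close> make
  the induction work, since integrating out one coordinate moves its mean into them.\<close>

lemma integral_PiM_sum_mult_sum:
  fixes f g :: "'i \<Rightarrow> 'a \<Rightarrow> real"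
  assumes N: "prob_space N" and I: "finite I"
    and f: "\<And>i. i \<in> I \<Longrightarrow> has_all_moments N (f i)" and g: "\<And>i. i \<in> I \<Longrightarrow> has_all_moments N (g i)"
  shows "(\<integral>z. (a + (\<Sum>i\<in>I. f i (z i))) * (b + (\<Sum>i\<in>I. g i (z i))) \<partial>(\<Pi>\<^sub>M i\<in>I. N)) =
    (a + (\<Sum>i\<in>I. integral\<^sup>L N (f i))) * (b + (\<Sum>i\<in>I. integral\<^sup>L N (g i))) +
    (\<Sum>i\<in>I. (\<integral>x. f i x * g i x \<partial>N) - integral\<^sup>L N (f i) * integral\<^sup>L N (g i))"
  using I f g
proof (induction I arbitrary: a b rule: finite_induct)
  case empty
  interpret prob_space "PiM {} (\<lambda>_. N)"
    by (rule prob_space_PiM) simp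
  show ?case
    by (simp add: prob_space)
next
  case (insert j I)
  interpret N: prob_space N by fact
  interpret P: product_prob_space "\<lambda>_. N"
    by (rule product_prob_spaceI) fact
  have PI: "prob_space (PiM (insert j I) (\<lambda>_. N))"
    by (rule prob_space_PiM) (rule N)
  let ?\<mu> = "integral\<^sup>L N (f j)" and ?\<nu> = "integral\<^sup>L N (g j)" and ?\<kappa> = "\<integral>x. f j x * g j x \<partial>N"
  have inner: "(\<integral>y. (A + f j y) * (B + g j y) \<partial>N) = (A + ?\<mu>) * (B + ?\<nu>) + (?\<kappa> - ?\<mu> * ?\<nu>)" for A B
  proof -
    have int: "integrable N (f j)" "integrable N (g j)" "integrable N (\<lambda>y. f j y * g j y)"
      using insert.prems by (auto intro: has_all_moments_integrable has_all_moments_mult)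
    have "(\<integral>y. (A + f j y) * (B + g j y) \<partial>N) =
        (\<integral>y. A * B + A * g j y + B * f j y + f j y * g j y \<partial>N)"
      by (simp add: algebra_simps)
    also have "\<dots> = A * B + A * ?\<nu> + B * ?\<mu> + ?\<kappa>"
      using int by (simp add: N.prob_space)
    finally show ?thesis
      by (simp add: algebra_simps)
  qed
  have "(\<integral>z. (a + (\<Sum>i\<in>insert j I. f i (z i))) * (b + (\<Sum>i\<in>insert j I. g i (z i)))
        \<partial>(PiM (insert j I) (\<lambda>_. N))) =
      (\<integral>z. (\<integral>y. (a + (\<Sum>i\<in>insert j I. f i ((z(j := y)) i))) *
        (b + (\<Sum>i\<in>insert j I. g i ((z(j := y)) i))) \<partial>N) \<partial>(PiM I (\<lambda>_. N)))"
    using insert PI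
    by (intro P.product_integral_insert has_all_moments_integrable has_all_moments_mult
        has_all_moments_add has_all_moments_const has_all_moments_sum
        has_all_moments_PiM[where M = "\<lambda>_. N"]) (use N in auto)
  also have "\<dots> = (\<integral>z. (\<integral>y. ((a + (\<Sum>i\<in>I. f i (z i))) + f j y) * ((b + (\<Sum>i\<in>I. g i (z i))) + g j y) \<partial>N)
      \<partial>(PiM I (\<lambda>_. N)))"
  proof -
    have "(\<Sum>i\<in>insert j I. h i ((z(j := y)) i)) = (\<Sum>i\<in>I. h i (z i)) + h j y"
      for h :: "'i \<Rightarrow> 'a \<Rightarrow> real" and z y
      using insert.hyps by (auto intro: sum.cong)
    then show ?thesis
      by (simp add: algebra_simps)
  qed
  also have "\<dots> = (\<integral>z. ((a + ?\<mu>) + (\<Sum>i\<in>I. f i (z i))) * ((b + ?\<nu>) + (\<Sum>i\<in>I. g i (z i))) +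
      (?\<kappa> - ?\<mu> * ?\<nu>) \<partial>(PiM I (\<lambda>_. N)))"
    unfolding inner by (simp add: algebra_simps)
  also have "\<dots> = (\<integral>z. ((a + ?\<mu>) + (\<Sum>i\<in>I. f i (z i))) * ((b + ?\<nu>) + (\<Sum>i\<in>I. g i (z i)))
      \<partial>(PiM I (\<lambda>_. N))) + (?\<kappa> - ?\<mu> * ?\<nu>)"
  proof -
    have PI: "prob_space (PiM I (\<lambda>_. N))"
      by (rule prob_space_PiM) (rule N)
    then have "integrable (PiM I (\<lambda>_. N))
        (\<lambda>z. ((a + ?\<mu>) + (\<Sum>i\<in>I. f i (z i))) * ((b + ?\<nu>) + (\<Sum>i\<in>I. g i (z i))))"
      using insert.prems N
      by (intro has_all_moments_integrable has_all_moments_mult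
        has_all_moments_add has_all_moments_const has_all_moments_sum
        has_all_moments_PiM[where M = "\<lambda>_. N"]) (use N in auto)
    then show ?thesis
      by (simp add: prob_space.prob_space[OF PI] finite_measure.integrable_const[OF prob_space.finite_measure[OF PI]])
  qed
  also have "\<dots> = ((a + ?\<mu>) + (\<Sum>i\<in>I. integral\<^sup>L N (f i))) * ((b + ?\<nu>) + (\<Sum>i\<in>I. integral\<^sup>L N (g i))) +
    (\<Sum>i\<in>I. (\<integral>x. f i x * g i x \<partial>N) - integral\<^sup>L N (f i) * integral\<^sup>L N (g i)) + (?\<kappa> - ?\<mu> * ?\<nu>)"
    using insert.prems by (subst insert.IH) auto
  finally show ?case
    using insert.hyps by (simp add: algebra_simps)
qed

lemma integral_PiM_sum:
  fixes f :: "'i \<Rightarrow> 'a \<Rightarrow> real"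
  assumes N: "prob_space N" and I: "finite I" and f: "\<And>i. i \<in> I \<Longrightarrow> has_all_moments N (f i)"
  shows "(\<integral>z. a + (\<Sum>i\<in>I. f i (z i)) \<partial>(\<Pi>\<^sub>M i\<in>I. N)) = a + (\<Sum>i\<in>I. integral\<^sup>L N (f i))"
  using integral_PiM_sum_mult_sum[where b = 1 and g = "\<lambda>_ _. 0", OF N I f has_all_moments_const[OF N]]
  by simp

section \<open>Gaussian moments\<close>

lemma prob_space_std_normal: "prob_space std_normal_distribution"
  by (intro prob_space_normal_density) simp

lemma has_all_moments_std_normal: "has_all_moments std_normal_distribution (\<lambda>x. x)"
  by (simp add: has_all_moments_def integrable_std_normal_distribution_moment)

lemma std_normal_mean: "(\<integral>x. x \<partial>std_normal_distribution) = 0"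
  using integral_std_normal_distribution_moment_odd[of 1] by simp

lemma std_normal_second_moment: "(\<integral>x. x\<^sup>2 \<partial>std_normal_distribution) = 1"
  using std_normal_distribution_even_moments(1)[of 1] by simp

lemma std_normal_covariance: "(\<integral>x. (a * x) * (b * x) \<partial>std_normal_distribution) = a * b"
proof -
  have "(\<integral>x. (a * x) * (b * x) \<partial>std_normal_distribution) = (\<integral>x. (a * b) * x\<^sup>2 \<partial>std_normal_distribution)"
    by (simp add: power2_eq_square mult_ac)
  then show ?thesis
    by (simp add: std_normal_second_moment)
qed

lemma std_normal_fourth_moment: "(\<integral>x. x ^ 4 \<partial>std_normal_distribution) = 3"
  using std_normal_distribution_even_moments(1)[of 2] by (simp add: fact_numeral)

lemma prob_space_PiM_std_normal: "prob_space (\<Pi>\<^sub>M i\<in>I. std_normal_distribution)"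
  by (rule prob_space_PiM) (rule prob_space_std_normal)

lemma has_all_moments_PiM_std_normal:
  "i \<in> I \<Longrightarrow> has_all_moments (\<Pi>\<^sub>M i\<in>I. std_normal_distribution) (\<lambda>z. z i)"
  by (rule has_all_moments_PiM[where M = "\<lambda>_. std_normal_distribution"])
    (auto intro: prob_space_std_normal has_all_moments_std_normal)

text \<open>The linear form is a centred Gaussian whose variance is the sum of the squared
  coefficients, and the fourth moment is three times the squared variance. The induction integrates
  out one coordinate: odd powers vanish, and the even ones bring in the second moment of the
  remaining sum.\<close>

lemma std_normal_sum_fourth_moment:
  fixes v :: "'i \<Rightarrow> real"
  assumes "finite I"
  shows "(\<integral>z. (\<Sum>i\<in>I. v i * z i) ^ 4 \<partial>(\<Pi>\<^sub>M i\<in>I. std_normal_distribution)) = 3 * (\<Sum>i\<in>I. (v i)\<^sup>2)\<^sup>2"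
  using assms
proof (induction I rule: finite_induct)
  case empty
  interpret prob_space "PiM {} (\<lambda>_. std_normal_distribution)"
    by (rule prob_space_PiM_std_normal)
  show ?case
    by simp
next
  case (insert j I)
  let ?N = "std_normal_distribution"
  interpret N: prob_space ?N
    by (rule prob_space_std_normal)
  interpret P: product_prob_space "\<lambda>_. ?N"
    by (rule product_prob_spaceI) (rule prob_space_std_normal)
  interpret PI: prob_space "PiM I (\<lambda>_. ?N)"
    by (rule prob_space_PiM_std_normal)
  note int = integrable_std_normal_distribution_moment
  have inner: "(\<integral>y. (A + c * y) ^ 4 \<partial>?N) = A ^ 4 + 6 * c\<^sup>2 * A\<^sup>2 + 3 * c ^ 4" for A c :: real
  proof -
    have "(\<integral>y. (A + c * y) ^ 4 \<partial>?N) =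
        (\<integral>y. A ^ 4 + (4 * A ^ 3 * c) * y ^ 1 + (6 * c\<^sup>2 * A\<^sup>2) * y\<^sup>2 + (4 * A * c ^ 3) * y ^ 3 + c ^ 4 * y ^ 4 \<partial>?N)"
      by (intro Bochner_Integration.integral_cong) (auto, algebra)
    also have "\<dots> = A ^ 4 + (4 * A ^ 3 * c) * (\<integral>y. y ^ 1 \<partial>?N) + (6 * c\<^sup>2 * A\<^sup>2) * (\<integral>y. y\<^sup>2 \<partial>?N)
        + (4 * A * c ^ 3) * (\<integral>y. y ^ 3 \<partial>?N) + c ^ 4 * (\<integral>y. y ^ 4 \<partial>?N)"
      using int[of 1] int[of 2] int[of 3] int[of 4] N.prob_space by (simp del: power_one_right)
    finally show ?thesis
      using integral_std_normal_distribution_moment_odd[of 1] integral_std_normal_distribution_moment_odd[of 3]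
      by (simp add: std_normal_second_moment std_normal_fourth_moment)
  qed
  have second: "(\<integral>z. (\<Sum>i\<in>I. v i * z i)\<^sup>2 \<partial>PiM I (\<lambda>_. ?N)) = (\<Sum>i\<in>I. (v i)\<^sup>2)"
  proof -
    have "(\<integral>z. (0 + (\<Sum>i\<in>I. v i * z i)) * (0 + (\<Sum>i\<in>I. v i * z i)) \<partial>PiM I (\<lambda>_. ?N)) = (\<Sum>i\<in>I. (v i)\<^sup>2)"
      using insert.hyps
      by (subst integral_PiM_sum_mult_sum[where f = "\<lambda>i y. v i * y" and g = "\<lambda>i y. v i * y"])
        (auto intro!: has_all_moments_intros has_all_moments_std_normal prob_space_std_normal sum.cong
           simp: std_normal_mean std_normal_covariance power2_eq_square)
    then show ?thesis
      by (simp add: power2_eq_square)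
  qed
  have all: "has_all_moments (PiM I (\<lambda>_. ?N)) (\<lambda>z. \<Sum>i\<in>I. v i * z i)"
    by (intro has_all_moments_intros prob_space_PiM_std_normal has_all_moments_PiM_std_normal)
  have "(\<integral>z. (\<Sum>i\<in>insert j I. v i * z i) ^ 4 \<partial>PiM (insert j I) (\<lambda>_. ?N)) =
      (\<integral>z. (\<integral>y. (\<Sum>i\<in>insert j I. v i * (z(j := y)) i) ^ 4 \<partial>?N) \<partial>PiM I (\<lambda>_. ?N))"
    using insert.hyps
    by (intro P.product_integral_insert has_all_moments_integrable_power has_all_moments_intros
        prob_space_PiM_std_normal has_all_moments_PiM_std_normal)
  also have "\<dots> = (\<integral>z. (\<integral>y. ((\<Sum>i\<in>I. v i * z i) + v j * y) ^ 4 \<partial>?N) \<partial>PiM I (\<lambda>_. ?N))"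
  proof -
    have "(\<Sum>i\<in>insert j I. v i * (z(j := y)) i) = (\<Sum>i\<in>I. v i * z i) + v j * y" for z y
      using insert.hyps by (auto intro: sum.cong)
    then show ?thesis
      by simp
  qed
  also have "\<dots> = (\<integral>z. (\<Sum>i\<in>I. v i * z i) ^ 4 + 6 * (v j)\<^sup>2 * (\<Sum>i\<in>I. v i * z i)\<^sup>2 + 3 * (v j) ^ 4 \<partial>PiM I (\<lambda>_. ?N))"
    unfolding inner ..
  also have "\<dots> = 3 * (\<Sum>i\<in>I. (v i)\<^sup>2)\<^sup>2 + 6 * (v j)\<^sup>2 * (\<Sum>i\<in>I. (v i)\<^sup>2) + 3 * (v j) ^ 4"
    using has_all_moments_integrable_power[OF all]
    by (simp add: insert.IH second PI.prob_space)
  also have "\<dots> = 3 * (\<Sum>i\<in>insert j I. (v i)\<^sup>2)\<^sup>2"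
    using insert.hyps by (simp add: power2_sum algebra_simps power2_eq_square power4_eq_xxxx)
  finally show ?case .
qed

section \<open>The standard normal vector: measurability and moments up to order four\<close>

lemma measurable_vec_lambda [measurable]:
  assumes "\<And>i. sets (M i) = sets borel"
  shows "(\<lambda>z. \<chi> i. z i) \<in> PiM UNIV M \<rightarrow>\<^sub>M (borel :: (real ^ 'd) measure)"
proof (subst borel_measurable_euclidean_space, intro ballI)
  fix b :: "real ^ 'd"
  assume "b \<in> Basis"
  then obtain i where b: "b = axis i 1"
    by (auto simp: Basis_vec_def)
  have "(\<lambda>z. z i) \<in> PiM UNIV M \<rightarrow>\<^sub>M M i"
    by simp
  then have "(\<lambda>z. z i) \<in> borel_measurable (PiM UNIV M)"
    using assms by (simp add: measurable_cong_sets[OF refl assms])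
  then show "(\<lambda>z. (\<chi> i. z i) \<bullet> b) \<in> borel_measurable (PiM UNIV M)"
    by (simp add: b inner_axis)
qed

lemma borel_measurable_vec_nth [measurable]: "(\<lambda>x. x $ i) \<in> borel_measurable (borel :: (real ^ 'd) measure)"
  by (intro borel_measurable_continuous_onI continuous_intros)

lemma sets_std_normal_vec [simp, measurable_cong]: "sets std_normal_vec = sets borel"
  by (simp add: std_normal_vec_def)

lemma space_std_normal_vec [simp]: "space std_normal_vec = UNIV"
  by (simp add: std_normal_vec_def)

lemma measurable_vec_lambda_std_normal:
  "(\<lambda>z. \<chi> i. z i) \<in> (\<Pi>\<^sub>M i\<in>UNIV. std_normal_distribution) \<rightarrow>\<^sub>M (borel :: (real ^ 'd) measure)"
  by (rule measurable_vec_lambda) simp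

lemma prob_space_std_normal_vec: "prob_space std_normal_vec"
  unfolding std_normal_vec_def
  by (intro prob_space.prob_space_distr prob_space_PiM_std_normal measurable_vec_lambda_std_normal)

lemma has_all_moments_std_normal_vec: "has_all_moments std_normal_vec (\<lambda>x. x $ i)"
  unfolding std_normal_vec_def
  by (subst has_all_moments_distr_iff)
    (auto intro: measurable_vec_lambda_std_normal has_all_moments_PiM_std_normal)

lemma integral_std_normal_vec:
  fixes f :: "real ^ 'd \<Rightarrow> real"
  assumes "f \<in> borel_measurable borel"
  shows "integral\<^sup>L std_normal_vec f = (\<integral>z. f (\<chi> i. z i) \<partial>(\<Pi>\<^sub>M i\<in>UNIV. std_normal_distribution))"
  unfolding std_normal_vec_def using assms
  by (intro integral_distr measurable_vec_lambda_std_normal)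

lemma inner_vec_lambda: "v \<bullet> (\<chi> i. z i) = (\<Sum>i\<in>UNIV. v $ i * z i)"
  by (simp add: inner_vec_def)

lemma std_normal_vec_mean: "(\<integral>x. v \<bullet> x \<partial>std_normal_vec) = 0"
proof -
  have "(\<integral>z. 0 + (\<Sum>i\<in>UNIV. v $ i * z i) \<partial>(\<Pi>\<^sub>M i\<in>UNIV. std_normal_distribution)) = 0"
    by (subst integral_PiM_sum[where f = "\<lambda>i y. v $ i * y"])
      (auto intro!: has_all_moments_intros has_all_moments_std_normal prob_space_std_normal
         simp: std_normal_mean)
  then show ?thesis
    by (simp add: integral_std_normal_vec inner_vec_lambda)
qed

lemma std_normal_vec_covariance: "(\<integral>x. (u \<bullet> x) * (v \<bullet> x) \<partial>std_normal_vec) = u \<bullet> v"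
proof -
  have "(\<integral>z. (0 + (\<Sum>i\<in>UNIV. u $ i * z i)) * (0 + (\<Sum>i\<in>UNIV. v $ i * z i))
      \<partial>(\<Pi>\<^sub>M i\<in>UNIV. std_normal_distribution)) = u \<bullet> v"
  proof (subst integral_PiM_sum_mult_sum[where f = "\<lambda>i y. u $ i * y" and g = "\<lambda>i y. v $ i * y"])
    show "(0 + (\<Sum>i\<in>UNIV. \<integral>y. u $ i * y \<partial>std_normal_distribution)) *
        (0 + (\<Sum>i\<in>UNIV. \<integral>y. v $ i * y \<partial>std_normal_distribution)) +
        (\<Sum>i\<in>UNIV. (\<integral>x. u $ i * x * (v $ i * x) \<partial>std_normal_distribution) -
          (\<integral>y. u $ i * y \<partial>std_normal_distribution) * (\<integral>y. v $ i * y \<partial>std_normal_distribution)) = u \<bullet> v"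
      by (simp add: std_normal_mean std_normal_covariance inner_vec_def)
  qed (auto intro!: has_all_moments_intros has_all_moments_std_normal prob_space_std_normal)
  then show ?thesis
    by (simp add: integral_std_normal_vec inner_vec_lambda)
qed

lemma std_normal_vec_inner_fourth_moment: "(\<integral>x. (v \<bullet> x) ^ 4 \<partial>std_normal_vec) = 3 * (v \<bullet> v)\<^sup>2"
  using std_normal_sum_fourth_moment[of UNIV "\<lambda>i. v $ i"]
  by (simp add: integral_std_normal_vec inner_vec_lambda inner_vec_def power2_eq_square)

lemma has_all_moments_std_normal_vec_inner: "has_all_moments std_normal_vec (\<lambda>x. v \<bullet> x)"
  by (intro has_all_moments_intros prob_space_std_normal_vec has_all_moments_std_normal_vec)

text \<open>A special case of Isserlis' theorem, obtained by polarization.\<close>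
lemma std_normal_vec_isserlis:
  fixes u v e :: "real ^ 'd"
  shows "(\<integral>x. (u \<bullet> x) * (v \<bullet> x) * (e \<bullet> x)\<^sup>2 \<partial>std_normal_vec) = (u \<bullet> v) * (e \<bullet> e) + 2 * (u \<bullet> e) * (v \<bullet> e)"
proof -
  have int: "integrable std_normal_vec (\<lambda>x. (c \<bullet> x) ^ p)" for c :: "real ^ 'd" and p
    by (rule has_all_moments_integrable_power[OF has_all_moments_std_normal_vec_inner])
  \<comment> \<open>With s = \<open>a \<bullet> x\<close> and t = \<open>b \<bullet> x\<close>, the
    sum of (s + t)^4 and (s - t)^4 is 2 s^4 + 12 s^2 t^2 + 2 t^4, hence the divisor 12. A second
    polarization, of s t into squares, then handles two different factors \<open>u\<close> and
    \<open>v\<close>.\<close>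
  have sq: "(\<integral>x. (a \<bullet> x)\<^sup>2 * (b \<bullet> x)\<^sup>2 \<partial>std_normal_vec) = (a \<bullet> a) * (b \<bullet> b) + 2 * (a \<bullet> b)\<^sup>2" for a b :: "real ^ 'd"
  proof -
    have "(\<integral>x. (a \<bullet> x)\<^sup>2 * (b \<bullet> x)\<^sup>2 \<partial>std_normal_vec) =
        (\<integral>x. (((a + b) \<bullet> x) ^ 4 + ((a - b) \<bullet> x) ^ 4 - 2 * (a \<bullet> x) ^ 4 - 2 * (b \<bullet> x) ^ 4) / 12 \<partial>std_normal_vec)"
      by (intro Bochner_Integration.integral_cong refl)
        (simp add: inner_add_left inner_diff_left power2_eq_square power4_eq_xxxx algebra_simps)
    also have "\<dots> = (3 * ((a + b) \<bullet> (a + b))\<^sup>2 + 3 * ((a - b) \<bullet> (a - b))\<^sup>2 - 2 * (3 * (a \<bullet> a)\<^sup>2) - 2 * (3 * (b \<bullet> b)\<^sup>2)) / 12"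
      using int by (simp add: std_normal_vec_inner_fourth_moment)
    also have "\<dots> = (a \<bullet> a) * (b \<bullet> b) + 2 * (a \<bullet> b)\<^sup>2"
      by (simp add: inner_add_left inner_diff_left inner_add_right inner_diff_right inner_commute[of b a]
          power2_eq_square algebra_simps)
    finally show ?thesis .
  qed
  have "(\<integral>x. (u \<bullet> x) * (v \<bullet> x) * (e \<bullet> x)\<^sup>2 \<partial>std_normal_vec) =
      (\<integral>x. (((u + v) \<bullet> x)\<^sup>2 * (e \<bullet> x)\<^sup>2 - ((u - v) \<bullet> x)\<^sup>2 * (e \<bullet> x)\<^sup>2) / 4 \<partial>std_normal_vec)"
    by (intro Bochner_Integration.integral_cong refl)
      (simp add: inner_add_left inner_diff_left power2_eq_square algebra_simps)
  also have "\<dots> = (((u + v) \<bullet> (u + v)) * (e \<bullet> e) + 2 * ((u + v) \<bullet> e)\<^sup>2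
      - (((u - v) \<bullet> (u - v)) * (e \<bullet> e) + 2 * ((u - v) \<bullet> e)\<^sup>2)) / 4"
  proof -
    have "integrable std_normal_vec (\<lambda>x. (a \<bullet> x)\<^sup>2 * (b \<bullet> x)\<^sup>2)" for a b :: "real ^ 'd"
      by (intro has_all_moments_integrable has_all_moments_mult has_all_moments_power
          prob_space_std_normal_vec has_all_moments_std_normal_vec_inner)
    then show ?thesis
      by (simp add: sq)
  qed
  also have "\<dots> = (u \<bullet> v) * (e \<bullet> e) + 2 * (u \<bullet> e) * (v \<bullet> e)"
    by (simp add: inner_add_left inner_diff_left inner_add_right inner_diff_right inner_commute[of v u]
        power2_eq_square algebra_simps)
  finally show ?thesis .
qed

section \<open>Invariance of the Gaussian laws under change of sign\<close>

lemma distr_uminus_std_normal: "distr std_normal_distribution std_normal_distribution uminus = std_normal_distribution"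
proof -
  have "distributed std_normal_distribution lborel (\<lambda>x. 0 + (-1) * x) (normal_density (0 + (-1) * 0) (\<bar>-1\<bar> * 1))"
    by (rule prob_space.normal_density_affine[OF prob_space_std_normal])
      (auto simp: distributed_def distr_id2 measurable_ident_sets)
  then show ?thesis
    by (auto simp: distributed_def cong: distr_cong)
qed

lemma distr_uminus_std_normal_vec: "distr std_normal_vec std_normal_vec uminus = std_normal_vec"
proof -
  let ?N = "\<lambda>_::'a. std_normal_distribution"
  have P: "distr (PiM UNIV ?N) (PiM UNIV ?N) (compose UNIV uminus) = PiM UNIV ?N"
    by (subst distr_PiM_finite_prob_space') (auto intro: prob_space_std_normal simp: distr_uminus_std_normal)
  have m: "compose UNIV uminus \<in> PiM UNIV ?N \<rightarrow>\<^sub>M PiM UNIV ?N"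
    unfolding compose_def by measurable
  have "distr std_normal_vec std_normal_vec uminus =
      distr (PiM UNIV ?N) borel (uminus \<circ> (\<lambda>z. \<chi> i. z i))"
    unfolding std_normal_vec_def
    by (subst distr_distr) (auto intro!: distr_cong measurable_vec_lambda_std_normal)
  also have "\<dots> = distr (PiM UNIV ?N) borel ((\<lambda>z. \<chi> i. z i) \<circ> compose UNIV uminus)"
    by (rule distr_cong) (auto simp: compose_def vec_eq_iff)
  also have "\<dots> = distr (distr (PiM UNIV ?N) (PiM UNIV ?N) (compose UNIV uminus)) borel (\<lambda>z. \<chi> i. z i)"
    by (rule distr_distr[symmetric]) (auto intro: measurable_vec_lambda_std_normal m)
  finally show ?thesis
    by (simp add: P std_normal_vec_def)
qed

section \<open>Noise and task laws\<close>

lemma measurable_scale_std_normal: "(\<lambda>z. \<sigma> * z) \<in> std_normal_distribution \<rightarrow>\<^sub>M borel"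
  by simp

lemma sets_normal_noise [simp, measurable_cong]: "sets (normal_noise \<sigma>) = sets borel"
  by (simp add: normal_noise_def)

lemma prob_space_normal_noise: "prob_space (normal_noise \<sigma>)"
  unfolding normal_noise_def
  by (intro prob_space.prob_space_distr prob_space_std_normal measurable_scale_std_normal)

lemma has_all_moments_normal_noise: "has_all_moments (normal_noise \<sigma>) (\<lambda>x. x)"
  unfolding normal_noise_def
  by (subst has_all_moments_distr_iff)
    (auto intro!: has_all_moments_intros has_all_moments_std_normal prob_space_std_normal)

lemma normal_noise_second_moment: "(\<integral>x. x\<^sup>2 \<partial>normal_noise \<sigma>) = \<sigma>\<^sup>2"
  unfolding normal_noise_def
  by (subst integral_distr) (auto simp: std_normal_second_moment power_mult_distrib)

lemma distr_uminus_normal_noise: "distr (normal_noise \<sigma>) (normal_noise \<sigma>) uminus = normal_noise \<sigma>"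
proof -
  have "distr (normal_noise \<sigma>) (normal_noise \<sigma>) uminus =
      distr std_normal_distribution borel (uminus \<circ> (\<lambda>z. \<sigma> * z))"
    unfolding normal_noise_def by (subst distr_distr) (auto intro!: distr_cong)
  also have "\<dots> = distr std_normal_distribution borel ((\<lambda>z. \<sigma> * z) \<circ> uminus)"
    by (rule distr_cong) auto
  also have "\<dots> = distr (distr std_normal_distribution std_normal_distribution uminus) borel (\<lambda>z. \<sigma> * z)"
    by (rule distr_distr[symmetric]) auto
  finally show ?thesis
    by (simp add: distr_uminus_std_normal normal_noise_def)
qed

text \<open>This collects what the risk computation uses of a task law. Both the training mixture
  and the Gaussian test law satisfy it, so one computation serves for training and test.\<close>

definition symmetric_task_law :: "(real ^ 'd) measure \<Rightarrow> real ^ 'd ^ 'd \<Rightarrow> bool" where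
  "symmetric_task_law T S \<longleftrightarrow>
     prob_space T \<and> sets T = sets borel \<and> (\<forall>i. has_all_moments T (\<lambda>w. w $ i)) \<and>
     distr T borel uminus = T \<and> (\<forall>e. (\<integral>w. (e \<bullet> w)\<^sup>2 \<partial>T) = e \<bullet> (S *v e))"

lemma measurable_matrix_vector_mult [measurable]:
  "(\<lambda>z. A *v z) \<in> borel \<rightarrow>\<^sub>M (borel :: (real ^ 'd) measure)"
  by (intro borel_measurable_continuous_onI linear_continuous_on matrix_vector_mul_bounded_linear)

text \<open>The symmetric root R moves across the inner product, so the second moment along
  \<open>e\<close> is the squared norm of R e. The root is assumed to exist because
  \<open>psd_root\<close> is a choice that is meaningful only then.\<close>

lemma symmetric_task_law_normal_vec:
  assumes "is_psd_root S (psd_root S)"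
  shows "symmetric_task_law (normal_vec S) S"
proof -
  let ?R = "psd_root S"
  have m: "(\<lambda>z. ?R *v z) \<in> std_normal_vec \<rightarrow>\<^sub>M borel"
    by measurable
  have "has_all_moments (normal_vec S) (\<lambda>w. w $ i)" for i
    unfolding normal_vec_def
    by (subst has_all_moments_distr_iff)
      (auto intro!: has_all_moments_intros has_all_moments_std_normal_vec prob_space_std_normal_vec m)
  moreover have "distr (normal_vec S) borel uminus = normal_vec S"
  proof -
    have "distr (normal_vec S) borel uminus = distr std_normal_vec borel (uminus \<circ> (\<lambda>z. ?R *v z))"
      unfolding normal_vec_def by (subst distr_distr) (auto intro!: distr_cong m)
    also have "\<dots> = distr std_normal_vec borel ((\<lambda>z. ?R *v z) \<circ> uminus)"
      by (rule distr_cong) (auto simp: linear_neg[OF matrix_vector_mul_linear])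
    also have "\<dots> = distr (distr std_normal_vec std_normal_vec uminus) borel (\<lambda>z. ?R *v z)"
      by (rule distr_distr[symmetric]) (auto intro: m)
    finally show ?thesis
      by (simp add: distr_uminus_std_normal_vec normal_vec_def)
  qed
  moreover have "(\<integral>w. (e \<bullet> w)\<^sup>2 \<partial>normal_vec S) = e \<bullet> (S *v e)" for e
  proof -
    have R: "transpose ?R = ?R" "?R ** ?R = S"
      using assms by (auto simp: is_psd_root_def)
    have adj: "e \<bullet> (?R *v z) = (?R *v e) \<bullet> z" for e z
      using dot_lmul_matrix[of e ?R z] R(1) by (metis transpose_matrix_vector)
    have "(\<integral>w. (e \<bullet> w)\<^sup>2 \<partial>normal_vec S) = (\<integral>z. (e \<bullet> (?R *v z))\<^sup>2 \<partial>std_normal_vec)"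
      unfolding normal_vec_def by (rule integral_distr) (auto intro: m)
    also have "\<dots> = (?R *v e) \<bullet> (?R *v e)"
      by (simp add: adj power2_eq_square std_normal_vec_covariance)
    also have "\<dots> = e \<bullet> ((?R ** ?R) *v e)"
      by (simp add: adj flip: matrix_vector_mul_assoc)
    also have "\<dots> = e \<bullet> (S *v e)"
      by (simp only: R(2))
    finally show ?thesis .
  qed
  ultimately show ?thesis
    by (simp add: symmetric_task_law_def normal_vec_def prob_space.prob_space_distr[OF prob_space_std_normal_vec m])
qed

text \<open>Integrals over the mixture are first computed as nonnegative integrals
  (\<open>nn\<close>), where integrability over the mixture need not be known beforehand. Applied to
  absolute powers this gives finite moments; applied to squares it gives the second moment, the
  average of the two components.\<close>

lemma symmetric_task_law_mixture:
  fixes N :: "bool \<Rightarrow> (real ^ 'd) measure"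
  assumes N: "\<And>b. symmetric_task_law (N b) (S b)"
  shows "symmetric_task_law (measure_pmf (bernoulli_pmf (1/2)) \<bind> N) ((1/2) *\<^sub>R (S True + S False))"
proof -
  let ?B = "measure_pmf (bernoulli_pmf (1/2))"
  let ?T = "?B \<bind> N"
  have prob: "prob_space (N b)" and sets: "sets (N b) = sets borel"
    and mom: "has_all_moments (N b) (\<lambda>w. w $ i)" and sym: "distr (N b) borel uminus = N b"
    and cov: "(\<integral>w. (e \<bullet> w)\<^sup>2 \<partial>N b) = e \<bullet> (S b *v e)" for b e i
    using N by (auto simp: symmetric_task_law_def)
  have meas: "N \<in> ?B \<rightarrow>\<^sub>M prob_algebra borel"
    by (auto simp: space_prob_algebra prob sets)
  have meas': "N \<in> ?B \<rightarrow>\<^sub>M subprob_algebra borel"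
    using meas by (rule measurable_prob_algebraD)
  have setsT: "sets ?T = sets borel"
    by (rule sets_bind) (auto simp: sets)
  have nn: "(\<integral>\<^sup>+w. ennreal (f w) \<partial>?T) = ennreal (((\<integral>w. f w \<partial>N True) + (\<integral>w. f w \<partial>N False)) / 2)"
    if f: "f \<in> borel_measurable borel" "\<And>b. integrable (N b) f" "\<And>w. 0 \<le> f w" for f :: "real ^ 'd \<Rightarrow> real"
  proof -
    have nn: "(\<integral>\<^sup>+w. ennreal (f w) \<partial>N b) = ennreal (\<integral>w. f w \<partial>N b)" for b
      using f by (intro nn_integral_eq_integral) auto
    have "(\<integral>\<^sup>+w. ennreal (f w) \<partial>?T) = (\<integral>\<^sup>+b. (\<integral>\<^sup>+w. ennreal (f w) \<partial>N b) \<partial>?B)"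
      using f by (intro nn_integral_bind[OF _ meas']) auto
    also have "\<dots> = ennreal (\<integral>w. f w \<partial>N True) * ennreal (1/2) + ennreal (\<integral>w. f w \<partial>N False) * ennreal (1/2)"
      by (simp add: nn)
    also have "\<dots> = ennreal (((\<integral>w. f w \<partial>N True) + (\<integral>w. f w \<partial>N False)) / 2)"
    proof -
      have "ennreal a * ennreal (1/2) + ennreal b * ennreal (1/2) = ennreal ((a + b) / 2)"
        if "0 \<le> a" "0 \<le> b" for a b :: real
      proof -
        have "ennreal ((a + b) / 2) = ennreal (a * (1/2) + b * (1/2))"
          by (simp add: field_simps)
        also have "\<dots> = ennreal (a * (1/2)) + ennreal (b * (1/2))"
          using that by (intro ennreal_plus) auto
        also have "\<dots> = ennreal a * ennreal (1/2) + ennreal b * ennreal (1/2)"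
          using that by (intro arg_cong2[where f = "(+)"] ennreal_mult) auto
        finally show ?thesis ..
      qed
      then show ?thesis
        using f(3) by simp
    qed
    finally show ?thesis .
  qed
  have probT: "prob_space ?T"
    by (rule prob_space_bind'[OF _ meas]) (simp add: space_prob_algebra prob_space_measure_pmf)
  have "has_all_moments ?T (\<lambda>w. w $ i)" for i
    unfolding has_all_moments_def
  proof (intro conjI allI)
    show "(\<lambda>w. w $ i) \<in> borel_measurable ?T"
      by (simp add: measurable_cong_sets[OF setsT refl])
    fix p
    show "integrable ?T (\<lambda>w. (w $ i) ^ p)"
    proof (rule integrableI_bounded)
      show "(\<lambda>w. (w $ i) ^ p) \<in> borel_measurable ?T"
        by (simp add: measurable_cong_sets[OF setsT refl])
      have "(\<integral>\<^sup>+w. ennreal (norm ((w $ i) ^ p)) \<partial>?T) =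
          ennreal (((\<integral>w. norm ((w $ i) ^ p) \<partial>N True) + (\<integral>w. norm ((w $ i) ^ p) \<partial>N False)) / 2)"
        using has_all_moments_integrable_power[OF mom] by (intro nn) (auto intro!: integrable_norm)
      then show "(\<integral>\<^sup>+w. ennreal (norm ((w $ i) ^ p)) \<partial>?T) < \<infinity>"
        by simp
    qed
  qed
  moreover have "distr ?T borel uminus = ?T"
    by (subst distr_bind[OF meas']) (auto simp: sym)
  moreover have "(\<integral>w. (e \<bullet> w)\<^sup>2 \<partial>?T) = e \<bullet> (((1/2) *\<^sub>R (S True + S False)) *v e)" for e
  proof -
    have "integrable (N b) (\<lambda>w. (e \<bullet> w)\<^sup>2)" for b
      by (intro has_all_moments_integrable has_all_moments_intros prob mom)
    then have "(\<integral>\<^sup>+w. ennreal ((e \<bullet> w)\<^sup>2) \<partial>?T) = ennreal ((e \<bullet> (S True *v e) + e \<bullet> (S False *v e)) / 2)"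
      by (subst nn) (auto simp: cov)
    moreover have "0 \<le> e \<bullet> (S b *v e)" for b
      unfolding cov[symmetric] by simp
    ultimately have "(\<integral>w. (e \<bullet> w)\<^sup>2 \<partial>?T) = (e \<bullet> (S True *v e) + e \<bullet> (S False *v e)) / 2"
      by (subst integral_eq_nn_integral) (auto simp: measurable_cong_sets[OF setsT refl])
    then show ?thesis
      by (simp add: matrix_vector_mult_add_rdistrib inner_add_right flip: scaleR_matrix_vector_assoc)
  qed
  ultimately show ?thesis
    using probT setsT by (simp add: symmetric_task_law_def)
qed

section \<open>The risk of linear attention\<close>

text \<open>Writing \<open>W\<^sub>Q W\<^sub>K\<^sup>T\<close> in blocks, only the rows indexed by features matter, since the label of
  the query is masked.\<close>

definition key_block :: "('d::finite) weights \<Rightarrow> real ^ 'd ^ 'd" where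
  "key_block W = (case W of (WQ, WK, WV) \<Rightarrow> \<chi> i j. (WQ ** transpose WK) $ Some i $ Some j)"

definition key_label :: "('d::finite) weights \<Rightarrow> real ^ 'd" where
  "key_label W = (case W of (WQ, WK, WV) \<Rightarrow> \<chi> i. (WQ ** transpose WK) $ Some i $ None)"

definition value_block :: "('d::finite) weights \<Rightarrow> real ^ 'd" where
  "value_block W = (case W of (WQ, WK, WV) \<Rightarrow> \<chi> i. (WV *v axis None 1) $ Some i)"

definition value_label :: "('d::finite) weights \<Rightarrow> real" where
  "value_label W = (case W of (WQ, WK, WV) \<Rightarrow> (WV *v axis None 1) $ None)"

text \<open>The linear map applied to the empirical cross moment \<open>(1/k) \<Sum> y\<^sub>i x\<^sub>i\<close>.\<close>
definition effective_matrix :: "('d::finite) weights \<Rightarrow> real ^ 'd ^ 'd" where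
  "effective_matrix W =
     (\<chi> i. value_label W *\<^sub>R key_block W $ i + key_label W $ i *\<^sub>R value_block W)"

definition odd_residual ::
  "real ^ 'd ^ 'd \<Rightarrow> nat \<Rightarrow> (nat \<Rightarrow> real ^ 'd) \<Rightarrow> real ^ 'd \<Rightarrow> (nat \<Rightarrow> real) \<Rightarrow> real" where
  "odd_residual M k x w \<xi> =
     x (k + 1) \<bullet> (w - (1 / real k) *\<^sub>R (\<Sum>i=1..k. label x w \<xi> i *\<^sub>R (M *v x i))) + \<xi> (k + 1)"

text \<open>The two terms have degree 0 and 2 in the labels: key and value both read features, or
  both read the label.\<close>

definition even_residual ::
  "('d::finite) weights \<Rightarrow> nat \<Rightarrow> (nat \<Rightarrow> real ^ 'd) \<Rightarrow> real ^ 'd \<Rightarrow> (nat \<Rightarrow> real) \<Rightarrow> real" where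
  "even_residual W k x w \<xi> =
     x (k + 1) \<bullet> ((1 / real k) *\<^sub>R (\<Sum>i=1..k. (value_block W \<bullet> x i) *\<^sub>R (key_block W *v x i) +
       (value_label W * (label x w \<xi> i)\<^sup>2) *\<^sub>R key_label W))"

lemma sum_option_UNIV: "(\<Sum>j\<in>UNIV. f j) = f None + (\<Sum>j\<in>UNIV. f (Some j))"
  for f :: "'d::finite option \<Rightarrow> real"
  by (subst UNIV_option_conv, subst sum.insert) (auto simp: sum.reindex)

lemma linear_attention_prompt:
  "linear_attention W k (prompt k x y) =
     1 / real k * (\<Sum>i=1..k. (x (k + 1) \<bullet> (key_block W *v x i) + (x (k + 1) \<bullet> key_label W) * y i) *
       (value_block W \<bullet> x i + value_label W * y i))"
proof -
  obtain WQ WK WV where W: "W = (WQ, WK, WV)"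
    by (cases W)
  define A where "A = WQ ** transpose WK"
  define v where "v = WV *v axis None 1"
  have "((prompt k x y (k + 1) v* A) \<bullet> prompt k x y i) * (prompt k x y i \<bullet> v) =
      (x (k + 1) \<bullet> (key_block W *v x i) + (x (k + 1) \<bullet> key_label W) * y i) *
       (value_block W \<bullet> x i + value_label W * y i)" if "i \<in> {1..k}" for i
  proof -
    have "(prompt k x y (k + 1) v* A) \<bullet> prompt k x y i = prompt k x y (k + 1) \<bullet> (A *v prompt k x y i)"
      by (simp add: dot_lmul_matrix)
    also have "\<dots> = x (k + 1) \<bullet> (key_block W *v x i) + (x (k + 1) \<bullet> key_label W) * y i"
      using that
      by (simp add: inner_vec_def sum_option_UNIV prompt_def matrix_vector_mult_def W key_block_def
          key_label_def flip: A_def)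
        (simp add: algebra_simps sum.distrib sum_distrib_left sum_distrib_right)
    moreover have "prompt k x y i \<bullet> v = value_block W \<bullet> x i + value_label W * y i"
      using that
      by (simp add: inner_vec_def sum_option_UNIV prompt_def W value_block_def value_label_def
          mult.commute flip: v_def)
    ultimately show ?thesis
      by simp
  qed
  then have "(\<Sum>i=1..k. ((prompt k x y (k + 1) v* A) \<bullet> masked k (prompt k x y) i) * (masked k (prompt k x y) i \<bullet> v)) =
    (\<Sum>i=1..k. (x (k + 1) \<bullet> (key_block W *v x i) + (x (k + 1) \<bullet> key_label W) * y i) *
       (value_block W \<bullet> x i + value_label W * y i))"
    by (intro sum.cong refl) (simp add: masked_def)
  then show ?thesis
    by (simp add: linear_attention_def W masked_def flip: A_def v_def)
qed

text \<open>Each summand of the attention is a product of a key and a value, each affine in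
  \<open>y i\<close>. The two products linear in \<open>y i\<close> combine into the bilinear form
  of \<open>effective_matrix\<close>, a multiple of \<open>key_block\<close> plus the rank-one
  matrix built from \<open>key_label\<close> and \<open>value_block\<close>; the other two form the
  even part.\<close>

lemma residual_eq:
  "label x w \<xi> (k + 1) - linear_attention W k (prompt k x (label x w \<xi>)) =
     odd_residual (effective_matrix W) k x w \<xi> - even_residual W k x w \<xi>"
proof -
  have "effective_matrix W *v z =
      value_label W *\<^sub>R (key_block W *v z) + (value_block W \<bullet> z) *\<^sub>R key_label W" for z
    by (simp add: vec_eq_iff effective_matrix_def matrix_vector_mul_component inner_add_left)
  then show ?thesis
    by (simp add: linear_attention_prompt odd_residual_def even_residual_def label_def[of x w \<xi> "Suc k"]
        inner_diff_right inner_sum_right inner_add_right inner_commute[of w]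
        power2_eq_square ring_distribs sum.distrib sum_distrib_left mult_ac)
qed

lemma label_uminus: "\<xi>' i = - \<xi> i \<Longrightarrow> label x (- w) \<xi>' i = - label x w \<xi> i"
  by (simp add: label_def)

lemma odd_residual_uminus:
  assumes "\<And>i. i \<in> {1..k + 1} \<Longrightarrow> \<xi>' i = - \<xi> i"
  shows "odd_residual M k x (- w) \<xi>' = - odd_residual M k x w \<xi>"
proof -
  have "(\<Sum>i=1..k. label x (- w) \<xi>' i *\<^sub>R (M *v x i)) = - (\<Sum>i=1..k. label x w \<xi> i *\<^sub>R (M *v x i))"
    using assms by (auto simp: label_uminus simp flip: sum_negf intro!: sum.cong)
  then show ?thesis
    using assms[of "k + 1"] by (simp add: odd_residual_def inner_diff_right)
qed

lemma even_residual_uminus: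
  assumes "\<And>i. i \<in> {1..k + 1} \<Longrightarrow> \<xi>' i = - \<xi> i"
  shows "even_residual W k x (- w) \<xi>' = even_residual W k x w \<xi>"
  unfolding even_residual_def
  using assms by (intro arg_cong2[where f = inner] arg_cong2[where f = scaleR] sum.cong refl)
    (auto simp: label_uminus)

text \<open>Interpreted twice below: for the training mixture with prompt length n, and for the test
  law with prompt length m.\<close>

locale attention_data =
  fixes \<sigma> :: real and T :: "(real ^ 'd) measure" and S :: "real ^ 'd ^ 'd" and k :: nat
  assumes T: "symmetric_task_law T S" and k: "1 \<le> k"
begin

abbreviation "features_law \<equiv> \<Pi>\<^sub>M i\<in>{1..k + 1}. (std_normal_vec :: (real ^ 'd) measure)"
abbreviation "noise_law \<equiv> \<Pi>\<^sub>M i\<in>{1..k + 1}. normal_noise \<sigma>"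

lemma prob_space_task: "prob_space T"
  using T by (simp add: symmetric_task_law_def)

lemma has_all_moments_task: "has_all_moments T (\<lambda>w. w $ i)"
  using T by (simp add: symmetric_task_law_def)

lemma prob_space_features: "prob_space (\<Pi>\<^sub>M i\<in>I. std_normal_vec)"
  by (intro prob_space_PiM prob_space_std_normal_vec)

lemma prob_space_noise: "prob_space (\<Pi>\<^sub>M i\<in>I. normal_noise \<sigma>)"
  by (intro prob_space_PiM prob_space_normal_noise)

lemma has_all_moments_features:
  "i \<in> I \<Longrightarrow> has_all_moments (\<Pi>\<^sub>M i\<in>I. std_normal_vec) (\<lambda>x. x i $ a)"
  by (rule has_all_moments_PiM[where M = "\<lambda>_. std_normal_vec"])
    (auto intro: prob_space_std_normal_vec has_all_moments_std_normal_vec)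

lemma has_all_moments_noise:
  "i \<in> I \<Longrightarrow> has_all_moments (\<Pi>\<^sub>M i\<in>I. normal_noise \<sigma>) (\<lambda>x. x i)"
  by (rule has_all_moments_PiM[where M = "\<lambda>_. normal_noise \<sigma>"])
    (auto intro: prob_space_normal_noise has_all_moments_normal_noise)

lemma prob_space_task_noise: "prob_space (T \<Otimes>\<^sub>M noise_law)"
  by (intro prob_space_pair prob_space_task prob_space_noise)

lemma prob_space_data: "prob_space (data_law \<sigma> T k)"
  unfolding data_law_def by (intro prob_space_pair prob_space_features prob_space_task_noise)

lemma has_all_moments_data_features:
  "i \<in> {1..k + 1} \<Longrightarrow> has_all_moments (data_law \<sigma> T k) (\<lambda>\<omega>. fst \<omega> i $ a)"
  unfolding data_law_def
  by (rule has_all_moments_fst[OF prob_space_features prob_space_task_noise has_all_moments_features])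

lemma has_all_moments_data_task: "has_all_moments (data_law \<sigma> T k) (\<lambda>\<omega>. fst (snd \<omega>) $ a)"
  unfolding data_law_def
  by (rule has_all_moments_snd[OF prob_space_features prob_space_task_noise
        has_all_moments_fst[OF prob_space_task prob_space_noise has_all_moments_task]])

lemma has_all_moments_data_noise:
  "i \<in> {1..k + 1} \<Longrightarrow> has_all_moments (data_law \<sigma> T k) (\<lambda>\<omega>. snd (snd \<omega>) i)"
  unfolding data_law_def
  by (rule has_all_moments_snd[OF prob_space_features prob_space_task_noise
        has_all_moments_snd[OF prob_space_task prob_space_noise has_all_moments_noise]])

text \<open>Fubini with the features innermost: for fixed task vector and noise, the prompt
  contributes a sum of independent terms, to which \<open>integral_PiM_sum_mult_sum\<close>
  applies.\<close>

lemma integral_data_law: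
  fixes f :: "_ \<Rightarrow> _ \<Rightarrow> _ \<Rightarrow> real"
  assumes "integrable (data_law \<sigma> T k) (\<lambda>\<omega>. f (fst \<omega>) (fst (snd \<omega>)) (snd (snd \<omega>)))"
  shows "(\<integral>\<omega>. f (fst \<omega>) (fst (snd \<omega>)) (snd (snd \<omega>)) \<partial>data_law \<sigma> T k) =
    (\<integral>w. (\<integral>\<xi>. (\<integral>x. f x w \<xi> \<partial>features_law) \<partial>noise_law) \<partial>T)"
proof -
  interpret X: prob_space features_law
    by (rule prob_space_features)
  interpret TN: prob_space "T \<Otimes>\<^sub>M noise_law"
    by (rule prob_space_task_noise)
  interpret T: prob_space T
    by (rule prob_space_task)
  interpret N: prob_space noise_law
    by (rule prob_space_noise)
  interpret XTN: pair_sigma_finite features_law "T \<Otimes>\<^sub>M noise_law" ..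
  interpret TN': pair_sigma_finite T noise_law ..
  have f: "integrable (features_law \<Otimes>\<^sub>M (T \<Otimes>\<^sub>M noise_law)) (case_prod (\<lambda>x z. f x (fst z) (snd z)))"
    using assms by (simp add: data_law_def case_prod_unfold)
  have "(\<integral>\<omega>. f (fst \<omega>) (fst (snd \<omega>)) (snd (snd \<omega>)) \<partial>data_law \<sigma> T k) =
      (\<integral>z. (\<integral>x. f x (fst z) (snd z) \<partial>features_law) \<partial>(T \<Otimes>\<^sub>M noise_law))"
    using XTN.integral_snd[OF f] by (simp add: data_law_def case_prod_unfold)
  also have "\<dots> = (\<integral>w. (\<integral>\<xi>. (\<integral>x. f x w \<xi> \<partial>features_law) \<partial>noise_law) \<partial>T)"
    using TN'.integral_fst'[OF XTN.integrable_snd[OF f]] by simp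
  finally show ?thesis .
qed

lemma integral_data_law_uminus:
  assumes f: "f \<in> borel_measurable (data_law \<sigma> T k)"
  shows "(\<integral>\<omega>. f (fst \<omega>, - fst (snd \<omega>), compose {1..k + 1} uminus (snd (snd \<omega>))) \<partial>data_law \<sigma> T k) =
    (integral\<^sup>L (data_law \<sigma> T k) f :: real)"
proof -
  let ?X = features_law and ?N = noise_law
  \<comment> \<open>Points of the product space are extensional functions, so the sign change has to
    be restricted to the index set; \<open>compose\<close> does this.\<close>
  let ?c = "compose {1..k + 1} uminus :: (nat \<Rightarrow> real) \<Rightarrow> _"
  let ?h = "\<lambda>\<omega>. (fst \<omega>, - fst (snd \<omega>), ?c (snd (snd \<omega>)))"
  have setsT: "sets T = sets borel" and symT: "distr T T uminus = T"
    using T by (auto simp: symmetric_task_law_def cong: distr_cong)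
  have mT: "uminus \<in> T \<rightarrow>\<^sub>M T"
    by (simp add: measurable_cong_sets[OF setsT setsT])
  have mN: "?c \<in> ?N \<rightarrow>\<^sub>M ?N"
    unfolding compose_def by measurable
  have N: "distr ?N ?N ?c = ?N"
    by (subst distr_PiM_finite_prob_space')
      (auto intro: prob_space_normal_noise simp: distr_uminus_normal_noise)
  have mTN: "(\<lambda>(w, \<xi>). (- w, ?c \<xi>)) \<in> T \<Otimes>\<^sub>M ?N \<rightarrow>\<^sub>M T \<Otimes>\<^sub>M ?N"
    using mT mN by measurable
  have TN: "distr (T \<Otimes>\<^sub>M ?N) (T \<Otimes>\<^sub>M ?N) (\<lambda>(w, \<xi>). (- w, ?c \<xi>)) = T \<Otimes>\<^sub>M ?N"
  proof -
    have "sigma_finite_measure (distr ?N ?N ?c)"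
      unfolding N by (intro prob_space_imp_sigma_finite prob_space_noise)
    from pair_measure_distr[OF mT mN this] show ?thesis
      unfolding symT N by (rule sym)
  qed
  have "distr ?X ?X (\<lambda>x. x) \<Otimes>\<^sub>M distr (T \<Otimes>\<^sub>M ?N) (T \<Otimes>\<^sub>M ?N) (\<lambda>(w, \<xi>). (- w, ?c \<xi>)) =
      distr (data_law \<sigma> T k) (data_law \<sigma> T k) (\<lambda>(x, z). (x, (case z of (w, \<xi>) \<Rightarrow> (- w, ?c \<xi>))))"
    unfolding data_law_def
  proof (intro pair_measure_distr mTN)
    show "sigma_finite_measure (distr (T \<Otimes>\<^sub>M ?N) (T \<Otimes>\<^sub>M ?N) (\<lambda>(w, \<xi>). (- w, ?c \<xi>)))"
      unfolding TN by (intro prob_space_imp_sigma_finite prob_space_task_noise)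
  qed simp
  then have D: "distr (data_law \<sigma> T k) (data_law \<sigma> T k) ?h = data_law \<sigma> T k"
    unfolding TN distr_id data_law_def[symmetric] by (simp only: case_prod_unfold)
  have "?h \<in> data_law \<sigma> T k \<rightarrow>\<^sub>M data_law \<sigma> T k"
    unfolding data_law_def using mT mN by measurable
  then have "(\<integral>\<omega>. f (?h \<omega>) \<partial>data_law \<sigma> T k) = integral\<^sup>L (distr (data_law \<sigma> T k) (data_law \<sigma> T k) ?h) f"
    using f by (simp add: integral_distr)
  then show ?thesis
    by (simp only: D)
qed

lemma has_all_moments_odd_residual:
  "has_all_moments (data_law \<sigma> T k) (\<lambda>\<omega>. odd_residual M k (fst \<omega>) (fst (snd \<omega>)) (snd (snd \<omega>)))"
  unfolding odd_residual_def label_def vector_minus_component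
    vector_scaleR_component sum_component inner_diff_right inner_scaleR_right inner_sum_right
  by (intro has_all_moments_intros prob_space_data has_all_moments_data_features has_all_moments_data_task
      has_all_moments_data_noise) auto

lemma has_all_moments_even_residual:
  "has_all_moments (data_law \<sigma> T k) (\<lambda>\<omega>. even_residual W k (fst \<omega>) (fst (snd \<omega>)) (snd (snd \<omega>)))"
  unfolding even_residual_def label_def inner_add_right inner_scaleR_right inner_sum_right
  by (intro has_all_moments_intros prob_space_data has_all_moments_data_features has_all_moments_data_task
      has_all_moments_data_noise) auto

definition odd_risk :: "real ^ 'd ^ 'd \<Rightarrow> real" where
  "odd_risk M = (\<integral>\<omega>. (odd_residual M k (fst \<omega>) (fst (snd \<omega>)) (snd (snd \<omega>)))\<^sup>2 \<partial>data_law \<sigma> T k)"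

definition even_risk :: "'d weights \<Rightarrow> real" where
  "even_risk W = (\<integral>\<omega>. (even_residual W k (fst \<omega>) (fst (snd \<omega>)) (snd (snd \<omega>)))\<^sup>2 \<partial>data_law \<sigma> T k)"

text \<open>The law of the data is invariant under \<open>(w, \<xi>) \<mapsto> (-w, -\<xi>)\<close>, so the mixed term vanishes.\<close>
lemma risk_eq_odd_risk_plus_even_risk: "risk \<sigma> T k W = odd_risk (effective_matrix W) + even_risk W"
proof -
  let ?D = "data_law \<sigma> T k"
  let ?o = "\<lambda>\<omega>. odd_residual (effective_matrix W) k (fst \<omega>) (fst (snd \<omega>)) (snd (snd \<omega>))"
  let ?e = "\<lambda>\<omega>. even_residual W k (fst \<omega>) (fst (snd \<omega>)) (snd (snd \<omega>))"
  note m = has_all_moments_odd_residual[of "effective_matrix W"] has_all_moments_even_residual[of W]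
  let ?h = "\<lambda>\<omega>. (fst \<omega>, - fst (snd \<omega>), compose {1..k + 1} uminus (snd (snd \<omega>)))"
  have "?o (?h \<omega>) = - ?o \<omega>" and "?e (?h \<omega>) = ?e \<omega>" for \<omega>
    unfolding fst_conv snd_conv
    by (rule odd_residual_uminus even_residual_uminus; simp add: compose_def)+
  moreover have "(\<integral>\<omega>. ?o (?h \<omega>) * ?e (?h \<omega>) \<partial>?D) = (\<integral>\<omega>. ?o \<omega> * ?e \<omega> \<partial>?D)"
    by (rule integral_data_law_uminus[of "\<lambda>\<omega>. ?o \<omega> * ?e \<omega>"])
      (intro has_all_moments_measurable has_all_moments_mult m)
  ultimately have "(\<integral>\<omega>. ?o \<omega> * ?e \<omega> \<partial>?D) = (\<integral>\<omega>. - (?o \<omega> * ?e \<omega>) \<partial>?D)"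
    by simp
  then have cross: "(\<integral>\<omega>. ?o \<omega> * ?e \<omega> \<partial>?D) = 0"
    by simp
  have "risk \<sigma> T k W = (\<integral>\<omega>. (?o \<omega>)\<^sup>2 + (?e \<omega>)\<^sup>2 - 2 * (?o \<omega> * ?e \<omega>) \<partial>?D)"
    unfolding risk_def case_prod_unfold residual_eq
    by (simp add: power2_diff mult.assoc)
  also have "\<dots> = odd_risk (effective_matrix W) + even_risk W"
    using m by (simp add: cross odd_risk_def even_risk_def has_all_moments_integrable_power
        has_all_moments_integrable[OF has_all_moments_mult])
  finally show ?thesis .
qed

end

section \<open>Gaussian moments with an affine factor, which represents a label with fixed
  noise\<close>

lemma std_normal_vec_third_moment: "(\<integral>x. (u \<bullet> x) * (v \<bullet> x)\<^sup>2 \<partial>std_normal_vec) = 0"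
proof -
  have "(\<integral>x. (u \<bullet> x) * (v \<bullet> x)\<^sup>2 \<partial>std_normal_vec) =
      (\<integral>x. (u \<bullet> x) * (v \<bullet> x)\<^sup>2 \<partial>(distr std_normal_vec std_normal_vec uminus))"
    by (simp only: distr_uminus_std_normal_vec)
  also have "\<dots> = - (\<integral>x. (u \<bullet> x) * (v \<bullet> x)\<^sup>2 \<partial>std_normal_vec)"
    by (subst integral_distr) auto
  finally show ?thesis
    by simp
qed

lemma integrable_std_normal_vec_products:
  "integrable std_normal_vec (\<lambda>x. u \<bullet> x)"
  "integrable std_normal_vec (\<lambda>x. (u \<bullet> x) * (v \<bullet> x))"
  "integrable std_normal_vec (\<lambda>x. (u \<bullet> x) * (v \<bullet> x)\<^sup>2)"
  "integrable std_normal_vec (\<lambda>x. (u \<bullet> x) * (v \<bullet> x) * (e \<bullet> x)\<^sup>2)"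
  by (intro has_all_moments_integrable has_all_moments_mult has_all_moments_power
      prob_space_std_normal_vec has_all_moments_std_normal_vec_inner)+

lemma prob_std_normal_vec_UNIV [simp]: "measure std_normal_vec UNIV = 1"
  using prob_space.prob_space[OF prob_space_std_normal_vec] by simp

lemma integrable_std_normal_vec_const [simp]: "integrable std_normal_vec (\<lambda>_. c :: real)"
  using prob_space_std_normal_vec prob_space.finite_measure by (intro finite_measure.integrable_const) blast

lemma std_normal_vec_affine_covariance:
  "(\<integral>x. (w \<bullet> x + c) * (m \<bullet> x) \<partial>std_normal_vec) = w \<bullet> m"
  by (simp add: distrib_right integrable_std_normal_vec_products std_normal_vec_covariance std_normal_vec_mean)

lemma std_normal_vec_affine_square:
  "(\<integral>x. (w \<bullet> x + c)\<^sup>2 \<partial>std_normal_vec) = w \<bullet> w + c\<^sup>2"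
proof -
  have "(\<integral>x. (w \<bullet> x + c)\<^sup>2 \<partial>std_normal_vec) =
      (\<integral>x. (w \<bullet> x) * (w \<bullet> x) + (2 * c) * (w \<bullet> x) + c\<^sup>2 \<partial>std_normal_vec)"
    by (intro Bochner_Integration.integral_cong refl) (simp add: power2_eq_square algebra_simps)
  also have "\<dots> = w \<bullet> w + c\<^sup>2"
    by (simp add: integrable_std_normal_vec_products std_normal_vec_covariance std_normal_vec_mean)
  finally show ?thesis .
qed

lemma std_normal_vec_affine_square_mult_square:
  "(\<integral>x. (w \<bullet> x + c)\<^sup>2 * (m \<bullet> x)\<^sup>2 \<partial>std_normal_vec) =
     (w \<bullet> w) * (m \<bullet> m) + 2 * (w \<bullet> m)\<^sup>2 + c\<^sup>2 * (m \<bullet> m)"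
proof -
  have "(\<integral>x. (w \<bullet> x + c)\<^sup>2 * (m \<bullet> x)\<^sup>2 \<partial>std_normal_vec) =
      (\<integral>x. (w \<bullet> x) * (w \<bullet> x) * (m \<bullet> x)\<^sup>2 + (2 * c) * ((w \<bullet> x) * (m \<bullet> x)\<^sup>2)
        + c\<^sup>2 * ((m \<bullet> x) * (m \<bullet> x)) \<partial>std_normal_vec)"
    by (intro Bochner_Integration.integral_cong refl) (simp add: power2_eq_square algebra_simps)
  also have "\<dots> = (w \<bullet> w) * (m \<bullet> m) + 2 * (w \<bullet> m)\<^sup>2 + c\<^sup>2 * (m \<bullet> m)"
    by (simp add: integrable_std_normal_vec_products std_normal_vec_isserlis std_normal_vec_third_moment
        std_normal_vec_covariance) (simp add: power2_eq_square)
  finally show ?thesis .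
qed

lemma has_bochner_integral_const_prob:
  fixes c :: real
  assumes "prob_space M"
  shows "has_bochner_integral M (\<lambda>_. c) c"
  using assms
  by (simp add: has_bochner_integral_iff prob_space.prob_space prob_space.finite_measure finite_measure.integrable_const)

text \<open>The risk of predicting the label of the query \<open>x\<close> by \<open>x \<bullet> M h\<close>, where \<open>h\<close> is the empirical cross
  moment of a prompt of length \<open>k\<close> and the task vector has second moment \<open>S\<close>; the row \<open>M $ a\<close> predicts the
  \<open>a\<close>-th coordinate of the task vector.\<close>
definition moment_risk :: "real \<Rightarrow> real ^ 'd ^ 'd \<Rightarrow> nat \<Rightarrow> real ^ 'd ^ 'd \<Rightarrow> real" where
  "moment_risk \<sigma> S k M = \<sigma>\<^sup>2 + (\<Sum>a\<in>UNIV. (axis a 1 - M $ a) \<bullet> (S *v (axis a 1 - M $ a)) +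
     1 / real k * ((M $ a \<bullet> M $ a) * (trace S + \<sigma>\<^sup>2) + M $ a \<bullet> (S *v M $ a)))"

context attention_data
begin

abbreviation "prompt_features_law \<equiv> \<Pi>\<^sub>M i\<in>{1..k}. (std_normal_vec :: (real ^ 'd) measure)"

text \<open>The update hypotheses say that \<open>R\<close> and \<open>Q\<close> do not depend on
  the query. The query is integrated first: it is centred with identity covariance, so the bilinear
  term becomes an inner product and the offsets contribute only \<open>s * t\<close>.\<close>

lemma integral_query:
  fixes R Q :: "(nat \<Rightarrow> real ^ 'd) \<Rightarrow> real ^ 'd"
  assumes R: "\<And>x y. R (x(k + 1 := y)) = R x" and Q: "\<And>x y. Q (x(k + 1 := y)) = Q x"
    and mR: "\<And>a. has_all_moments features_law (\<lambda>x. R x $ a)"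
    and mQ: "\<And>a. has_all_moments features_law (\<lambda>x. Q x $ a)"
  shows "(\<integral>x. (x (k + 1) \<bullet> R x + s) * (x (k + 1) \<bullet> Q x + t) \<partial>features_law) =
    (\<integral>x. R x \<bullet> Q x + s * t \<partial>prompt_features_law)"
proof -
  interpret N: prob_space "std_normal_vec :: (real ^ 'd) measure"
    by (rule prob_space_std_normal_vec)
  interpret P: product_prob_space "\<lambda>_::nat. std_normal_vec :: (real ^ 'd) measure"
    by (rule product_prob_spaceI) (rule prob_space_std_normal_vec)
  have I: "{1..k + 1} = insert (k + 1) {1..k}"
    by auto
  have "integrable features_law (\<lambda>x. (x (k + 1) \<bullet> R x + s) * (x (k + 1) \<bullet> Q x + t))"
    by (intro has_all_moments_integrable has_all_moments_intros prob_space_features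
        has_all_moments_features mR mQ) auto
  then have "(\<integral>x. (x (k + 1) \<bullet> R x + s) * (x (k + 1) \<bullet> Q x + t) \<partial>features_law) =
      (\<integral>x. (\<integral>y. ((x(k + 1 := y)) (k + 1) \<bullet> R (x(k + 1 := y)) + s) *
        ((x(k + 1 := y)) (k + 1) \<bullet> Q (x(k + 1 := y)) + t) \<partial>std_normal_vec) \<partial>prompt_features_law)"
    unfolding I by (intro P.product_integral_insert) auto
  also have "\<dots> = (\<integral>x. R x \<bullet> Q x + s * t \<partial>prompt_features_law)"
  proof -
    have "(\<integral>y. (y \<bullet> r + s) * (y \<bullet> q + t) \<partial>std_normal_vec) = r \<bullet> q + s * t" for r q :: "real ^ 'd"
    proof -
      have "(\<integral>y. (y \<bullet> r + s) * (y \<bullet> q + t) \<partial>std_normal_vec) =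
          (\<integral>y. (r \<bullet> y) * (q \<bullet> y) + t * (r \<bullet> y) + s * (q \<bullet> y) + s * t \<partial>std_normal_vec)"
        by (simp add: inner_commute algebra_simps)
      then show ?thesis
        by (simp add: integrable_std_normal_vec_products std_normal_vec_covariance std_normal_vec_mean)
    qed
    then show ?thesis
      unfolding R Q fun_upd_same by (simp only:)
  qed
  finally show ?thesis .
qed

lemma integral_noise_square: "i \<in> {1..k + 1} \<Longrightarrow> has_bochner_integral noise_law (\<lambda>\<xi>. (\<xi> i)\<^sup>2) (\<sigma>\<^sup>2)"
proof -
  assume i: "i \<in> {1..k + 1}"
  have "(\<integral>\<xi>. (\<xi> i)\<^sup>2 \<partial>noise_law) = (\<integral>z. z\<^sup>2 \<partial>distr noise_law (normal_noise \<sigma>) (\<lambda>\<xi>. \<xi> i))"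
    using i by (intro integral_distr[symmetric]) auto
  also have "\<dots> = \<sigma>\<^sup>2"
    using distr_PiM_component[where M = "\<lambda>_. normal_noise \<sigma>", OF prob_space_normal_noise i]
    by (simp only: normal_noise_second_moment)
  finally show ?thesis
    using has_all_moments_integrable_power[OF has_all_moments_noise[OF i], of 2]
    by (simp add: has_bochner_integral_iff)
qed

lemma has_bochner_integral_task_square: "has_bochner_integral T (\<lambda>w. (e \<bullet> w)\<^sup>2) (e \<bullet> (S *v e))"
proof -
  have "integrable T (\<lambda>w. (e \<bullet> w)\<^sup>2)"
    by (intro has_all_moments_integrable has_all_moments_intros prob_space_task has_all_moments_task)
  then show ?thesis
    using T by (simp add: has_bochner_integral_iff symmetric_task_law_def)
qed

lemma has_bochner_integral_task_norm: "has_bochner_integral T (\<lambda>w. w \<bullet> w) (trace S)"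
proof -
  have "has_bochner_integral T (\<lambda>w. \<Sum>b\<in>UNIV. (axis b 1 \<bullet> w)\<^sup>2) (\<Sum>b\<in>UNIV. axis b 1 \<bullet> (S *v axis b 1))"
    by (intro has_bochner_integral_sum has_bochner_integral_task_square)
  moreover have "axis b 1 \<bullet> (S *v axis b 1) = S $ b $ b" for b
    by (simp add: inner_axis' matrix_vector_mul_component inner_axis)
  moreover have "(\<Sum>b\<in>UNIV. (axis b 1 \<bullet> w)\<^sup>2) = w \<bullet> w" for w :: "real ^ 'd"
    by (simp add: inner_axis' power2_eq_square inner_vec_def[of w w])
  ultimately show ?thesis
    by (simp add: trace_def)
qed

text \<open>With the query integrated out, what remains is the mean of |w - M h|^2 plus the squared
  query noise. The former is computed coordinate by coordinate as squared bias plus variance of a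
  sum of independent terms.\<close>

lemma integral_odd_residual_features:
  "(\<integral>x. (odd_residual M k x w \<xi>)\<^sup>2 \<partial>features_law) =
    (\<Sum>a\<in>UNIV. ((axis a 1 - M $ a) \<bullet> w)\<^sup>2 + (\<Sum>i=1..k. (1 / real k)\<^sup>2 *
      ((M $ a \<bullet> M $ a) * (w \<bullet> w + (\<xi> i)\<^sup>2) + (M $ a \<bullet> w)\<^sup>2))) + (\<xi> (k + 1))\<^sup>2"
proof -
  let ?P = prompt_features_law
  define R where "R x = w - (1 / real k) *\<^sub>R (\<Sum>i=1..k. label x w \<xi> i *\<^sub>R (M *v x i))" for x
  have upd: "R (x(k + 1 := y)) = R x" for x y
    by (auto simp: R_def label_def intro!: sum.cong)
  have mR: "has_all_moments (PiM J (\<lambda>_. std_normal_vec)) (\<lambda>x. R x $ a)" if "{1..k} \<subseteq> J" for J a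
    unfolding R_def label_def vector_minus_component vector_scaleR_component sum_component real_scaleR_def
    using that by (intro has_all_moments_intros prob_space_features has_all_moments_features) auto
  define f where "f a i x = (- (1 / real k)) * ((w \<bullet> x + \<xi> i) * (M $ a \<bullet> x))" for a i x
  have Ra: "R x $ a = w $ a + (\<Sum>i=1..k. f a i (x i))" for x a
    by (simp add: R_def f_def label_def matrix_vector_mul_component sum_negf sum_distrib_left)
  have mf: "has_all_moments std_normal_vec (f a i)" for a i
    unfolding f_def
    by (intro has_all_moments_intros prob_space_std_normal_vec has_all_moments_std_normal_vec)
  have f1: "integral\<^sup>L std_normal_vec (f a i) = - (1 / real k) * (M $ a \<bullet> w)" for a i
    by (simp add: f_def[abs_def] std_normal_vec_affine_covariance inner_commute[of "M $ a" w])
  have f2: "(\<integral>x. f a i x * f a i x \<partial>std_normal_vec) = (1 / real k)\<^sup>2 *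
      ((M $ a \<bullet> M $ a) * (w \<bullet> w + (\<xi> i)\<^sup>2) + 2 * (M $ a \<bullet> w)\<^sup>2)" for a i
  proof -
    have "(\<integral>x. f a i x * f a i x \<partial>std_normal_vec) =
        (\<integral>x. (1 / real k)\<^sup>2 * ((w \<bullet> x + \<xi> i)\<^sup>2 * (M $ a \<bullet> x)\<^sup>2) \<partial>std_normal_vec)"
      by (simp add: f_def power2_eq_square mult_ac)
    also have "\<dots> = (1 / real k)\<^sup>2 * ((w \<bullet> w) * (M $ a \<bullet> M $ a) + 2 * (w \<bullet> M $ a)\<^sup>2
        + (\<xi> i)\<^sup>2 * (M $ a \<bullet> M $ a))"
      by (simp add: std_normal_vec_affine_square_mult_square)
    finally show ?thesis
      by (simp add: inner_commute[of w "M $ a"] algebra_simps)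
  qed
  \<comment> \<open>\<open>f2\<close> contains (M_a . w)^2 twice; the variance subtracts the squared
    mean, which leaves it once. The means add up to the bias, the first summand.\<close>
  have component: "(\<integral>x. R x $ a * R x $ a \<partial>?P) = ((axis a 1 - M $ a) \<bullet> w)\<^sup>2 + (\<Sum>i=1..k. (1 / real k)\<^sup>2 *
      ((M $ a \<bullet> M $ a) * (w \<bullet> w + (\<xi> i)\<^sup>2) + (M $ a \<bullet> w)\<^sup>2))" for a
    unfolding Ra
    using k
    by (subst integral_PiM_sum_mult_sum[OF prob_space_std_normal_vec _ mf mf], simp)
      (simp add: f1 f2 inner_diff_left inner_axis' power2_eq_square algebra_simps)
  have "(\<integral>x. (odd_residual M k x w \<xi>)\<^sup>2 \<partial>features_law) = (\<integral>x. R x \<bullet> R x + \<xi> (k + 1) * \<xi> (k + 1) \<partial>?P)"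
    unfolding odd_residual_def power2_eq_square R_def[symmetric]
    by (rule integral_query[OF upd upd mR mR]) auto
  also have "\<dots> = (\<Sum>a\<in>UNIV. \<integral>x. R x $ a * R x $ a \<partial>?P) + (\<xi> (k + 1))\<^sup>2"
  proof -
    have "integrable ?P (\<lambda>x. R x $ a * R x $ a)" for a
      by (intro has_all_moments_integrable has_all_moments_mult mR) auto
    then show ?thesis
      unfolding inner_vec_def inner_real_def power2_eq_square
      by (intro has_bochner_integral_integral_eq has_bochner_integral_add has_bochner_integral_sum
          has_bochner_integral_integrable has_bochner_integral_const_prob prob_space_features)
  qed
  finally show ?thesis
    by (simp only: component)
qed

text \<open>The conditional risk is a quadratic polynomial in w and \<xi> without mixed terms, so
  the remaining integrations only replace squares by their second moments. This is why the shape of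
  the task law beyond \<open>S\<close> is invisible to the risk.\<close>

lemma odd_risk_eq: "odd_risk M = moment_risk \<sigma> S k M"
proof -
  have noise: "(\<integral>\<xi>. (\<integral>x. (odd_residual M k x w \<xi>)\<^sup>2 \<partial>features_law) \<partial>noise_law) =
      (\<Sum>a\<in>UNIV. ((axis a 1 - M $ a) \<bullet> w)\<^sup>2 + (\<Sum>i=1..k. (1 / real k)\<^sup>2 *
        ((M $ a \<bullet> M $ a) * (w \<bullet> w + \<sigma>\<^sup>2) + (M $ a \<bullet> w)\<^sup>2))) + \<sigma>\<^sup>2" for w
    unfolding integral_odd_residual_features
    by (intro has_bochner_integral_integral_eq has_bochner_integral_add has_bochner_integral_sum
        has_bochner_integral_mult_right integral_noise_square has_bochner_integral_const_prob
        prob_space_noise) auto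
  have "(\<integral>w. (\<Sum>a\<in>UNIV. ((axis a 1 - M $ a) \<bullet> w)\<^sup>2 + (\<Sum>i=1..k. (1 / real k)\<^sup>2 *
        ((M $ a \<bullet> M $ a) * (w \<bullet> w + \<sigma>\<^sup>2) + (M $ a \<bullet> w)\<^sup>2))) + \<sigma>\<^sup>2 \<partial>T) =
     (\<Sum>a\<in>UNIV. (axis a 1 - M $ a) \<bullet> (S *v (axis a 1 - M $ a)) + (\<Sum>i=1..k. (1 / real k)\<^sup>2 *
        ((M $ a \<bullet> M $ a) * (trace S + \<sigma>\<^sup>2) + M $ a \<bullet> (S *v M $ a)))) + \<sigma>\<^sup>2"
    by (intro has_bochner_integral_integral_eq has_bochner_integral_add has_bochner_integral_sum
        has_bochner_integral_mult_right has_bochner_integral_const_prob prob_space_task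
        has_bochner_integral_task_square has_bochner_integral_task_norm)
  also have "\<dots> = moment_risk \<sigma> S k M"
    using k by (simp add: moment_risk_def power2_eq_square)
  finally show ?thesis
    unfolding odd_risk_def
    by (subst integral_data_law[OF has_all_moments_integrable_power[OF has_all_moments_odd_residual]])
      (simp only: noise)
qed

text \<open>The test polynomial \<open>(e \<bullet> x\<^sub>i)\<^sup>2 - e \<bullet> e\<close> is centred, so only its correlation with the part of the
  residual that is quadratic in the same \<open>x\<^sub>i\<close> survives.\<close>
lemma integral_even_residual_features:
  "(\<integral>x. even_residual W k x w \<xi> * (x (k + 1) \<bullet> ((\<Sum>i=1..k. (e \<bullet> x i)\<^sup>2 - e \<bullet> e) *\<^sub>R a)) \<partial>features_law) =
    2 * ((value_block W \<bullet> e) * (a \<bullet> (key_block W *v e)) + value_label W * (a \<bullet> key_label W) * (e \<bullet> w)\<^sup>2)"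
proof -
  let ?P = prompt_features_law
  define u where "u = value_block W"
  define B where "B = key_block W"
  define b where "b = key_label W"
  define c where "c = value_label W"
  define R where "R x = (1 / real k) *\<^sub>R (\<Sum>i=1..k. (u \<bullet> x i) *\<^sub>R (B *v x i) +
       (c * (label x w \<xi> i)\<^sup>2) *\<^sub>R b)" for x
  define Q where "Q x = (\<Sum>i=1..k. (e \<bullet> x i)\<^sup>2 - e \<bullet> e) *\<^sub>R a" for x
  have upd: "R (x(k + 1 := y)) = R x" "Q (x(k + 1 := y)) = Q x" for x y
    by (auto simp: R_def Q_def label_def intro!: sum.cong arg_cong2[where f = scaleR])
  have mR: "has_all_moments features_law (\<lambda>x. R x $ a)" for a
    unfolding R_def label_def vector_add_component vector_scaleR_component sum_component real_scaleR_def
    by (intro has_all_moments_intros prob_space_features has_all_moments_features) auto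
  have mQ: "has_all_moments features_law (\<lambda>x. Q x $ a)" for a
    unfolding Q_def vector_scaleR_component real_scaleR_def
    by (intro has_all_moments_intros prob_space_features has_all_moments_features) auto
  define f where "f i x = (1 / real k) * ((u \<bullet> x) * ((a v* B) \<bullet> x) + (c * (a \<bullet> b)) * (w \<bullet> x + \<xi> i)\<^sup>2)" for i :: nat and x
  define g where "g x = (e \<bullet> x)\<^sup>2 - e \<bullet> e" for x
  have mf: "has_all_moments std_normal_vec (f i)" for i
    unfolding f_def
    by (intro has_all_moments_intros prob_space_std_normal_vec has_all_moments_std_normal_vec)
  have mg: "has_all_moments std_normal_vec g"
    unfolding g_def
    by (intro has_all_moments_intros prob_space_std_normal_vec has_all_moments_std_normal_vec)
  have g1: "integral\<^sup>L std_normal_vec g = 0"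
    using integrable_std_normal_vec_products(2)[of e e]
    by (simp add: g_def[abs_def] power2_eq_square std_normal_vec_covariance)
  \<comment> \<open>Centring by \<open>e \<bullet> e\<close> cancels the Isserlis terms proportional
    to it, and the pairings with \<open>e\<close> remain with their factor 2. Summing over the k
    examples later cancels 1 / k.\<close>
  have fg: "(\<integral>x. f i x * g x \<partial>std_normal_vec) =
      2 / real k * ((u \<bullet> e) * (a \<bullet> (B *v e)) + c * (a \<bullet> b) * (e \<bullet> w)\<^sup>2)" for i
  proof -
    have int: "integrable std_normal_vec (\<lambda>x. (w \<bullet> x + \<xi> i)\<^sup>2)"
      "integrable std_normal_vec (\<lambda>x. (w \<bullet> x + \<xi> i)\<^sup>2 * (e \<bullet> x)\<^sup>2)"
      by (intro has_all_moments_integrable has_all_moments_intros prob_space_std_normal_vec has_all_moments_std_normal_vec)+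
    have "(\<integral>x. f i x * g x \<partial>std_normal_vec) =
        (\<integral>x. (1 / real k) * (((u \<bullet> x) * ((a v* B) \<bullet> x) * (e \<bullet> x)\<^sup>2 - (e \<bullet> e) * ((u \<bullet> x) * ((a v* B) \<bullet> x)))
         + (c * (a \<bullet> b)) * ((w \<bullet> x + \<xi> i)\<^sup>2 * (e \<bullet> x)\<^sup>2 - (e \<bullet> e) * (w \<bullet> x + \<xi> i)\<^sup>2)) \<partial>std_normal_vec)"
      by (intro Bochner_Integration.integral_cong refl)
        (simp add: f_def g_def algebra_simps add_divide_distrib diff_divide_distrib)
    also have "\<dots> = (1 / real k) * (((u \<bullet> (a v* B)) * (e \<bullet> e) + 2 * (u \<bullet> e) * ((a v* B) \<bullet> e) - (e \<bullet> e) * (u \<bullet> (a v* B)))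
         + (c * (a \<bullet> b)) * ((w \<bullet> w) * (e \<bullet> e) + 2 * (w \<bullet> e)\<^sup>2 + (\<xi> i)\<^sup>2 * (e \<bullet> e) - (e \<bullet> e) * (w \<bullet> w + (\<xi> i)\<^sup>2)))"
      using int
      by (simp add: integrable_std_normal_vec_products std_normal_vec_isserlis std_normal_vec_covariance
          std_normal_vec_affine_square std_normal_vec_affine_square_mult_square)
    also have "\<dots> = 2 / real k * ((u \<bullet> e) * (a \<bullet> (B *v e)) + c * (a \<bullet> b) * (e \<bullet> w)\<^sup>2)"
      by (simp add: dot_lmul_matrix inner_commute[of w e] algebra_simps)
    finally show ?thesis .
  qed
  have "R x \<bullet> Q x = (0 + (\<Sum>i=1..k. f i (x i))) * (0 + (\<Sum>i=1..k. g (x i)))" for x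
  proof -
    have "a \<bullet> R x = (\<Sum>i=1..k. f i (x i))"
      by (simp add: R_def f_def label_def inner_sum_right inner_add_right dot_lmul_matrix
          sum_distrib_left sum_divide_distrib mult_ac)
    then show ?thesis
      by (simp add: Q_def g_def inner_commute[of "R x"])
  qed
  then have "(\<integral>x. R x \<bullet> Q x \<partial>?P) = (\<integral>x. (0 + (\<Sum>i=1..k. f i (x i))) * (0 + (\<Sum>i=1..k. g (x i))) \<partial>?P)"
    by simp
  also have "\<dots> = (\<Sum>i=1..k. 2 / real k * ((u \<bullet> e) * (a \<bullet> (B *v e)) + c * (a \<bullet> b) * (e \<bullet> w)\<^sup>2))"
    by (subst integral_PiM_sum_mult_sum[OF prob_space_std_normal_vec _ mf mg]) (simp_all add: g1 fg)
  also have "\<dots> = 2 * ((u \<bullet> e) * (a \<bullet> (B *v e)) + c * (a \<bullet> b) * (e \<bullet> w)\<^sup>2)"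
    using k by simp
  finally show ?thesis
    using integral_query[OF upd mR mQ, of 0 0]
    by (simp add: even_residual_def R_def Q_def u_def B_def b_def c_def)
qed

text \<open>Zero risk makes the even residual vanish almost surely, hence orthogonal to the test
  polynomial. The value of that integral is already known, and integrating over the task vector
  turns \<open>(e \<bullet> w)\<^sup>2\<close> into \<open>e \<bullet> (S *v e)\<close>; the outcome
  is a relation between the blocks alone.\<close>

lemma even_risk_zeroD:
  assumes "even_risk W = 0"
  shows "(value_block W \<bullet> e) * (a \<bullet> (key_block W *v e)) + value_label W * (a \<bullet> key_label W) * (e \<bullet> (S *v e)) = 0"
proof -
  let ?E = "\<lambda>\<omega>. even_residual W k (fst \<omega>) (fst (snd \<omega>)) (snd (snd \<omega>))"
  let ?q = "\<lambda>x. x (k + 1) \<bullet> ((\<Sum>i=1..k. (e \<bullet> x i)\<^sup>2 - e \<bullet> e) *\<^sub>R a)"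
  have "integrable (data_law \<sigma> T k) (\<lambda>\<omega>. (?E \<omega>)\<^sup>2)"
    by (rule has_all_moments_integrable_power[OF has_all_moments_even_residual])
  then have "AE \<omega> in data_law \<sigma> T k. ?E \<omega> = 0"
    using assms integral_nonneg_eq_0_iff_AE[of "data_law \<sigma> T k" "\<lambda>\<omega>. (?E \<omega>)\<^sup>2"]
    by (simp add: even_risk_def)
  then have "(\<integral>\<omega>. ?E \<omega> * ?q (fst \<omega>) \<partial>data_law \<sigma> T k) = 0"
    by (intro integral_eq_zero_AE) auto
  moreover have "integrable (data_law \<sigma> T k) (\<lambda>\<omega>. ?E \<omega> * ?q (fst \<omega>))"
    unfolding inner_scaleR_right
    by (intro has_all_moments_integrable has_all_moments_mult[OF has_all_moments_even_residual]
        has_all_moments_intros prob_space_data has_all_moments_data_features) auto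
  ultimately have "(\<integral>w. (\<integral>\<xi>. (\<integral>x. even_residual W k x w \<xi> * ?q x \<partial>features_law) \<partial>noise_law) \<partial>T) = 0"
    using integral_data_law[of "\<lambda>x w \<xi>. even_residual W k x w \<xi> * ?q x"] by simp
  moreover have "(\<integral>\<xi>. c \<partial>noise_law) = c" for c :: real
    by (simp add: prob_space.prob_space[OF prob_space_noise])
  ultimately have "(\<integral>w. 2 * ((value_block W \<bullet> e) * (a \<bullet> (key_block W *v e)) +
      value_label W * (a \<bullet> key_label W) * (e \<bullet> w)\<^sup>2) \<partial>T) = 0"
    unfolding integral_even_residual_features by (simp only:)
  moreover have "(\<integral>w. 2 * ((value_block W \<bullet> e) * (a \<bullet> (key_block W *v e)) +
      value_label W * (a \<bullet> key_label W) * (e \<bullet> w)\<^sup>2) \<partial>T) =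
      2 * ((value_block W \<bullet> e) * (a \<bullet> (key_block W *v e)) + value_label W * (a \<bullet> key_label W) * (e \<bullet> (S *v e)))"
    by (intro has_bochner_integral_integral_eq has_bochner_integral_add
        has_bochner_integral_mult_right has_bochner_integral_const_prob prob_space_task
        has_bochner_integral_task_square)
  ultimately show ?thesis
    by simp
qed

text \<open>In dimension at least 2 some nonzero e is orthogonal to \<open>value_block W\<close>. At
  this e the block relation loses its first term, and since \<open>e \<bullet> (S *v e)\<close> is
  nonzero, \<open>value_label W\<close> or \<open>key_label W\<close> vanishes. The relation then
  kills the remaining term for every e. These are the summands of the residual, so it is 0 for every
  length \<open>k'\<close> and all data.\<close>

lemma even_residual_eq_0:
  assumes even: "even_risk W = 0" and S: "\<And>e. e \<noteq> 0 \<Longrightarrow> e \<bullet> (S *v e) \<noteq> 0" and d: "2 \<le> CARD('d)"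
  shows "even_residual W k' x w \<xi> = 0"
proof -
  have *: "(value_block W \<bullet> e) *\<^sub>R (key_block W *v e) + (value_label W * (e \<bullet> (S *v e))) *\<^sub>R key_label W = 0" for e
  proof (rule vector_eq_ldot[THEN iffD1], rule allI)
    fix a
    show "a \<bullet> ((value_block W \<bullet> e) *\<^sub>R (key_block W *v e) + (value_label W * (e \<bullet> (S *v e))) *\<^sub>R key_label W) =
        a \<bullet> 0"
      using even_risk_zeroD[OF even, of e a] by (simp add: inner_add_right mult_ac)
  qed
  obtain e where "e \<noteq> 0" "value_block W \<bullet> e = 0"
    using orthogonal_to_vector_exists[of "value_block W"] d by (auto simp: orthogonal_def)
  with *[of e] S[of e] have cb: "value_label W = 0 \<or> key_label W = 0"
    by auto
  then have zero: "(value_block W \<bullet> e) *\<^sub>R (key_block W *v e) = 0" for e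
    using *[of e] by auto
  have "(value_block W \<bullet> x i) *\<^sub>R (key_block W *v x i) +
      (value_label W * (label x w \<xi> i)\<^sup>2) *\<^sub>R key_label W = 0" for i
    using cb by (simp only: zero) auto
  then show ?thesis
    by (simp only: even_residual_def sum.neutral_const scaleR_zero_right inner_zero_right)
qed

end

section \<open>The optimal weights\<close>

text \<open>The key matrix is the transpose of \<open>M\<close> padded by zeros, because attention
  transposes it again. With the identity as value matrix, the value reads off the label only, so the
  prediction is exactly x . M h.\<close>

definition cross_moment_weights :: "real ^ 'd ^ 'd \<Rightarrow> ('d::finite) weights" where
  "cross_moment_weights M =
     (mat 1, \<chi> q p. (case (p, q) of (Some i, Some j) \<Rightarrow> M $ i $ j | _ \<Rightarrow> 0), mat 1)"

lemma cross_moment_weights_blocks: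
  "key_label (cross_moment_weights M) = 0" "value_block (cross_moment_weights M) = 0"
  "value_label (cross_moment_weights M) = 1" "key_block (cross_moment_weights M) = M"
  by (auto simp: cross_moment_weights_def key_label_def value_block_def value_label_def key_block_def
      vec_eq_iff transpose_def axis_def)

lemma effective_matrix_cross_moment_weights: "effective_matrix (cross_moment_weights M) = M"
  by (simp add: effective_matrix_def cross_moment_weights_blocks vec_eq_iff)

lemma even_residual_cross_moment_weights: "even_residual (cross_moment_weights M) k x w \<xi> = 0"
  by (simp add: even_residual_def cross_moment_weights_blocks)

context attention_data
begin

lemma even_risk_nonneg: "0 \<le> even_risk W"
  unfolding even_risk_def by (intro integral_nonneg_AE) auto

lemma risk_eq: "risk \<sigma> T k W = moment_risk \<sigma> S k (effective_matrix W) + even_risk W"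
  by (simp add: risk_eq_odd_risk_plus_even_risk odd_risk_eq)

lemma risk_cross_moment_weights: "risk \<sigma> T k (cross_moment_weights M) = moment_risk \<sigma> S k M"
  by (simp add: risk_eq effective_matrix_cross_moment_weights even_risk_def even_residual_cross_moment_weights)

lemma optimal_weightsD:
  assumes "optimal_weights \<sigma> T k W"
  shows "even_risk W = 0" and "moment_risk \<sigma> S k (effective_matrix W) \<le> moment_risk \<sigma> S k M"
proof -
  have *: "moment_risk \<sigma> S k (effective_matrix W) + even_risk W \<le> moment_risk \<sigma> S k M" for M
    using assms risk_cross_moment_weights[of M] unfolding optimal_weights_def risk_eq[of W] by metis
  show "even_risk W = 0"
    \<comment> \<open>Comparison with weights of the same effective matrix leaves only the even
      part.\<close>
    using *[of "effective_matrix W"] even_risk_nonneg[of W] by simp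
  then show "moment_risk \<sigma> S k (effective_matrix W) \<le> moment_risk \<sigma> S k M"
    using *[of M] by simp
qed

end

text \<open>The hypothesis \<open>normal\<close> is the normal equation for the row \<open>M0 $ a\<close>; the proof completes the square.\<close>
lemma moment_risk_minimizer_unique:
  fixes S M M0 :: "real ^ 'd ^ 'd"
  assumes sym: "transpose S = S" and psd: "\<And>v. 0 \<le> v \<bullet> (S *v v)" and k: "1 \<le> k"
    and \<tau>: "0 < trace S + \<sigma>\<^sup>2"
    and normal: "\<And>a. S *v (axis a 1 - M0 $ a) =
      (1 / real k) *\<^sub>R (S *v (M0 $ a) + (trace S + \<sigma>\<^sup>2) *\<^sub>R M0 $ a)"
    and le: "moment_risk \<sigma> S k M \<le> moment_risk \<sigma> S k M0"
  shows "M = M0"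
proof -
  define \<tau> where "\<tau> = trace S + \<sigma>\<^sup>2"
  define D where "D = M - M0"
  define q where "q m a = (axis a 1 - m) \<bullet> (S *v (axis a 1 - m)) + 1 / real k * ((m \<bullet> m) * \<tau> + m \<bullet> (S *v m))"
    for m and a :: 'd
  have adj: "u \<bullet> (S *v v) = v \<bullet> (S *v u)" for u v
    using dot_lmul_matrix[of u S v] sym by (metis inner_commute transpose_matrix_vector)
  have row: "q (M $ a) a = q (M0 $ a) a + (1 + 1 / real k) * (D $ a \<bullet> (S *v D $ a)) + \<tau> / real k * (D $ a \<bullet> D $ a)" for a
  proof -
    define m d e where "m = M0 $ a" and "d = D $ a" and "e = axis a 1 - M0 $ a"
    have M: "M $ a = m + d" and e: "axis a 1 - (m + d) = e - d"
      by (simp_all add: m_def d_def e_def D_def)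
    have h1: "d \<bullet> (S *v e) = (1 / real k) * (d \<bullet> (S *v m) + \<tau> * (d \<bullet> m))"
      using normal[of a] by (simp add: e_def m_def \<tau>_def inner_add_right)
    have h2: "(e - d) \<bullet> (S *v (e - d)) = e \<bullet> (S *v e) - 2 * (d \<bullet> (S *v e)) + d \<bullet> (S *v d)"
      by (simp add: matrix_vector_mult_diff_distrib inner_diff_left inner_diff_right adj[of e d])
    have h3: "(m + d) \<bullet> (S *v (m + d)) = m \<bullet> (S *v m) + 2 * (d \<bullet> (S *v m)) + d \<bullet> (S *v d)"
      by (simp add: matrix_vector_right_distrib inner_add_left inner_add_right adj[of m d])
    have h4: "(m + d) \<bullet> (m + d) = m \<bullet> m + 2 * (d \<bullet> m) + d \<bullet> d"
      by (simp add: inner_add_left inner_add_right inner_commute[of m d])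
    have "q (m + d) a = q m a + (1 + 1 / real k) * (d \<bullet> (S *v d)) + \<tau> / real k * (d \<bullet> d)"
      unfolding q_def e h2 h3 h4 h1 e_def[folded m_def, symmetric]
      by (simp add: add_divide_distrib algebra_simps)
    then show ?thesis
      by (simp add: M m_def d_def)
  qed
  define r where "r a = (1 + 1 / real k) * (D $ a \<bullet> (S *v D $ a)) + \<tau> / real k * (D $ a \<bullet> D $ a)" for a
  have "(\<Sum>a\<in>UNIV. q (M $ a) a) \<le> (\<Sum>a\<in>UNIV. q (M0 $ a) a)"
    using le by (simp add: moment_risk_def q_def \<tau>_def)
  then have le0: "sum r UNIV \<le> 0"
    by (simp add: row r_def sum.distrib)
  have pos1: "0 \<le> (1 + 1 / real k) * (D $ a \<bullet> (S *v D $ a))" for a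
    using psd by (intro mult_nonneg_nonneg) auto
  have pos2: "0 \<le> \<tau> / real k * (D $ a \<bullet> D $ a)" for a
    using \<tau> by (intro mult_nonneg_nonneg) (auto simp: \<tau>_def)
  have pos: "0 \<le> r a" for a
    unfolding r_def by (intro add_nonneg_nonneg pos1 pos2)
  have "sum r UNIV = 0"
    by (intro antisym le0 sum_nonneg pos)
  then have "r a = 0" for a
    using pos by (subst (asm) sum_nonneg_eq_0_iff) auto
  then have "\<tau> / real k * (D $ a \<bullet> D $ a) = 0" for a
    \<comment> \<open>Both summands of \<open>r a\<close> vanish. The one with the positive factor
      \<open>\<tau> / real k\<close> provides the strict convexity that a semidefinite
      \<open>S\<close> does not.\<close>
    using pos1[of a] pos2[of a] unfolding r_def by (metis add_nonneg_eq_0_iff)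
  then have "D $ a = 0" for a
    using \<tau> k by (simp add: \<tau>_def)
  then show ?thesis
    by (simp add: D_def vec_eq_iff)
qed

section \<open>Continuity of the risk formula and its limit for long prompts\<close>

lemma tendsto_matrix_vector_mult [tendsto_intros]:
  fixes A :: "'a \<Rightarrow> real ^ 'n ^ 'm"
  assumes "(A \<longlongrightarrow> A0) F" "(v \<longlongrightarrow> v0) F"
  shows "((\<lambda>x. A x *v v x) \<longlongrightarrow> A0 *v v0) F"
  unfolding matrix_vector_mult_def
  using assms by (intro tendsto_vec_lambda tendsto_sum tendsto_mult tendsto_vec_nth)

lemma tendsto_trace [tendsto_intros]:
  fixes A :: "'a \<Rightarrow> real ^ 'n ^ 'n"
  assumes "(A \<longlongrightarrow> A0) F"
  shows "((\<lambda>x. trace (A x)) \<longlongrightarrow> trace A0) F"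
  unfolding trace_def using assms by (intro tendsto_sum tendsto_vec_nth)

lemma tendsto_moment_risk:
  assumes "(S \<longlongrightarrow> S0) F" "(M \<longlongrightarrow> M0) F"
  shows "((\<lambda>x. moment_risk \<sigma> (S x) k (M x)) \<longlongrightarrow> moment_risk \<sigma> S0 k M0) F"
  unfolding moment_risk_def by (intro tendsto_intros assms)

lemma moment_risk_tendsto_infinite_prompt:
  "(\<lambda>k. moment_risk \<sigma> S k M) \<longlonglongrightarrow>
     \<sigma>\<^sup>2 + (\<Sum>a\<in>UNIV. (axis a 1 - M $ a) \<bullet> (S *v (axis a 1 - M $ a)))"
proof -
  have "(\<lambda>k. moment_risk \<sigma> S k M) \<longlonglongrightarrow>
     \<sigma>\<^sup>2 + (\<Sum>a\<in>UNIV. (axis a 1 - M $ a) \<bullet> (S *v (axis a 1 - M $ a)) +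
       0 * ((M $ a \<bullet> M $ a) * (trace S + \<sigma>\<^sup>2) + M $ a \<bullet> (S *v M $ a)))"
    unfolding moment_risk_def by (intro tendsto_intros lim_1_over_n)
  then show ?thesis
    by simp
qed

section \<open>Subspaces\<close>

lemma inner_transpose_mult: "v \<bullet> ((U ** transpose U) *v v) = (transpose U *v v) \<bullet> (transpose U *v v)"
  for U :: "real ^ 'k ^ 'd"
  by (simp add: dot_lmul_matrix flip: matrix_vector_mul_assoc)

lemma transpose_add: "transpose (A + B) = transpose A + transpose B"
  by (simp add: transpose_def vec_eq_iff)

lemma transpose_mult_eq_0_commute:
  fixes A :: "real ^ 'm ^ 'd" and B :: "real ^ 'n ^ 'd"
  assumes "transpose A ** B = 0"
  shows "transpose B ** A = 0"
proof -
  have "transpose (transpose A ** B) = 0"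
    by (simp only: assms) (simp add: transpose_def vec_eq_iff)
  then show ?thesis
    by (simp add: matrix_transpose_mul)
qed

lemma projection_span:
  fixes U :: "real ^ 'k ^ 'd"
  assumes "orthonormal_columns U" "v \<in> span (columns U)"
  shows "(U ** transpose U) *v v = v"
  using assms(2)
proof (induction rule: span_induct)
  case base
  show ?case
    by (auto simp: subspace_def matrix_vector_right_distrib matrix_vector_mult_scaleR)
next
  case (step u)
  then obtain j where u: "u = U *v axis j 1"
    by (auto simp: columns_def matrix_vector_mult_basis)
  have "(U ** transpose U) *v (U *v axis j 1) = U *v ((transpose U ** U) *v axis j 1)"
    by (simp add: matrix_mul_assoc matrix_vector_mul_assoc)
  then show ?case
    using assms(1) by (simp add: u orthonormal_columns_def)
qed

text \<open>Two orthogonal projections with the same range agree. Q fixes the span and maps into it,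
  so Q P = P and P Q = Q; transposing the latter gives Q P = Q, hence P = Q.\<close>

lemma projection_sum_eq:
  fixes U1 U2 :: "real ^ 'r ^ 'd" and U :: "real ^ 'q ^ 'd"
  assumes U1: "orthonormal_columns U1" and U2: "orthonormal_columns U2" and orth: "transpose U1 ** U2 = 0"
    and U: "orthonormal_columns U"
    and span: "span (columns U) = {u + v | u v. u \<in> span (columns U1) \<and> v \<in> span (columns U2)}"
  shows "U1 ** transpose U1 + U2 ** transpose U2 = U ** transpose U"
proof -
  define P where "P = U ** transpose U"
  define Q where "Q = U1 ** transpose U1 + U2 ** transpose U2"
  note orth' = transpose_mult_eq_0_commute[OF orth]
  have kill: "(B ** transpose B) *v v = 0" if "transpose B ** A = 0" "v \<in> span (columns A)" "orthonormal_columns A"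
    for A B :: "real ^ 'r ^ 'd" and v
  proof -
    have "(B ** transpose B) *v v = (B ** transpose B) *v ((A ** transpose A) *v v)"
      using projection_span[OF that(3,2)] by simp
    also have "\<dots> = B *v ((transpose B ** A) *v (transpose A *v v))"
      by (simp only: matrix_vector_mul_assoc matrix_mul_assoc)
    finally show ?thesis
      using that(1) by simp
  qed
  have Qv: "Q *v v = v" if v: "v \<in> span (columns U)" for v
  proof -
    obtain u w where "v = u + w" "u \<in> span (columns U1)" "w \<in> span (columns U2)"
      using v unfolding span by auto
    then show ?thesis
      using projection_span[OF U1] projection_span[OF U2] kill[OF orth _ U2] kill[OF orth' _ U1]
      by (simp add: Q_def matrix_vector_mult_add_rdistrib matrix_vector_right_distrib)
  qed
  have inQ: "Q *v v \<in> span (columns U)" for v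
  proof -
    have "Q *v v = U1 *v (transpose U1 *v v) + U2 *v (transpose U2 *v v)"
      by (simp only: Q_def matrix_vector_mult_add_rdistrib matrix_vector_mul_assoc)
    moreover have "U1 *v (transpose U1 *v v) \<in> span (columns U1)" "U2 *v (transpose U2 *v v) \<in> span (columns U2)"
      by (rule matrix_vector_mult_in_columnspace)+
    ultimately show ?thesis
      unfolding span by blast
  qed
  have inP: "P *v v \<in> span (columns U)" for v
    unfolding P_def matrix_vector_mul_assoc[symmetric] by (rule matrix_vector_mult_in_columnspace)
  have "Q ** P = P"
    using Qv[OF inP] by (simp add: matrix_eq flip: matrix_vector_mul_assoc)
  moreover have "P ** Q = Q"
    using projection_span[OF U inQ] by (simp add: matrix_eq P_def[symmetric] flip: matrix_vector_mul_assoc)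
  then have "transpose Q ** transpose P = transpose Q"
    by (metis matrix_transpose_mul)
  then have "Q ** P = Q"
    by (simp add: P_def Q_def transpose_add matrix_transpose_mul)
  ultimately show ?thesis
    by (simp add: P_def Q_def)
qed

lemma task_cov_mult: "task_cov \<epsilon> U *v v = (U ** transpose U) *v v + \<epsilon> *\<^sub>R v"
  by (simp add: task_cov_def matrix_vector_mult_add_rdistrib flip: scaleR_matrix_vector_assoc)

lemma trace_projection:
  fixes U :: "real ^ 'k ^ 'd"
  shows "orthonormal_columns U \<Longrightarrow> trace (U ** transpose U) = real CARD('k)"
  by (simp add: orthonormal_columns_def trace_mul_sym[of U] trace_I)

lemma trace_eq_sum_inner: "trace A = (\<Sum>a\<in>UNIV. axis a 1 \<bullet> (A *v axis a 1))"
  for A :: "real ^ 'd ^ 'd"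
  by (simp add: trace_def inner_axis' matrix_vector_mul_component inner_axis)

text \<open>For symmetric P this is \<alpha> P + \<beta> (I - P). It is given by rows because the
  risk and the normal equations are stated row by row.\<close>

definition shrinkage :: "real \<Rightarrow> real \<Rightarrow> real ^ 'd ^ 'd \<Rightarrow> real ^ 'd ^ 'd" where
  "shrinkage \<alpha> \<beta> P = (\<chi> a. \<alpha> *\<^sub>R (P *v axis a 1) + \<beta> *\<^sub>R (axis a 1 - P *v axis a 1))"

section \<open>Training on the mixture\<close>

text \<open>The second moment of the mixture: each component covers one of two orthogonal halves of
  the span and has weight 1/2, hence the factor on the projection.\<close>

definition mean_task_cov :: "real \<Rightarrow> real ^ 'k ^ 'd \<Rightarrow> real ^ 'd ^ 'd" where
  "mean_task_cov \<epsilon> U = (1/2) *\<^sub>R (U ** transpose U) + \<epsilon> *\<^sub>R mat 1"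

lemma mean_task_cov_mult: "mean_task_cov \<epsilon> U *v v = (1/2) *\<^sub>R ((U ** transpose U) *v v) + \<epsilon> *\<^sub>R v"
  by (simp add: mean_task_cov_def matrix_vector_mult_add_rdistrib flip: scaleR_matrix_vector_assoc)

lemma trace_mean_task_cov:
  fixes U :: "real ^ 'k ^ 'd"
  assumes "orthonormal_columns U"
  shows "trace (mean_task_cov \<epsilon> U) = real CARD('k) / 2 + \<epsilon> * real CARD('d)"
proof -
  have "trace (c *\<^sub>R A) = c * trace A" for c and A :: "real ^ 'd ^ 'd"
    by (simp add: trace_def sum_distrib_left)
  then show ?thesis
    by (simp add: mean_task_cov_def trace_add trace_projection[OF assms] trace_I)
qed

lemma symmetric_mixture_task_law:
  assumes U1: "orthonormal_columns U1" and U2: "orthonormal_columns U2"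
    and sum: "U1 ** transpose U1 + U2 ** transpose U2 = U ** transpose U" and \<epsilon>: "0 \<le> \<epsilon>"
  shows "symmetric_task_law (mixture_task_law \<epsilon> U1 U2) (mean_task_cov \<epsilon> U)"
proof -
  have "symmetric_task_law (normal_vec (task_cov \<epsilon> (if b then U1 else U2))) (task_cov \<epsilon> (if b then U1 else U2))" for b
    using U1 U2 \<epsilon> by (intro symmetric_task_law_normal_vec is_psd_root_task_cov) auto
  from symmetric_task_law_mixture[where S = "\<lambda>b. task_cov \<epsilon> (if b then U1 else U2)", OF this]
  have "symmetric_task_law (mixture_task_law \<epsilon> U1 U2) ((1/2) *\<^sub>R (task_cov \<epsilon> U1 + task_cov \<epsilon> U2))"
    by (simp add: mixture_task_law_def)
  also have "(1/2) *\<^sub>R (task_cov \<epsilon> U1 + task_cov \<epsilon> U2) = mean_task_cov \<epsilon> U"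
  proof -
    have "(1/2) *\<^sub>R (task_cov \<epsilon> U1 + task_cov \<epsilon> U2) =
        (1/2) *\<^sub>R (U1 ** transpose U1 + U2 ** transpose U2) + (1/2) *\<^sub>R (\<epsilon> *\<^sub>R mat 1 + \<epsilon> *\<^sub>R mat 1)"
      by (simp add: task_cov_def algebra_simps)
    also have "\<dots> = (1/2) *\<^sub>R (U ** transpose U) + \<epsilon> *\<^sub>R mat 1"
      unfolding sum by (simp flip: scaleR_2)
    finally show ?thesis
      by (simp add: mean_task_cov_def)
  qed
  finally show ?thesis .
qed

text \<open>The eigenvalues of the minimizer of \<open>moment_risk\<close> for the training law, on the span of the
  task subspaces and on its orthogonal complement.\<close>
definition span_gain :: "real \<Rightarrow> real \<Rightarrow> nat \<Rightarrow> real" where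
  "span_gain \<tau> \<epsilon> n = real n * (1/2 + \<epsilon>) / ((real n + 1) * (1/2 + \<epsilon>) + \<tau>)"

definition complement_gain :: "real \<Rightarrow> real \<Rightarrow> nat \<Rightarrow> real" where
  "complement_gain \<tau> \<epsilon> n = real n * \<epsilon> / ((real n + 1) * \<epsilon> + \<tau>)"

text \<open>The normal equation restricted to an eigenspace of the training second moment with
  eigenvalue \<open>s\<close>. It is used with \<open>s\<close> equal to 1/2 + \<epsilon> and to
  \<epsilon>.\<close>

lemma shrinkage_gain_equation:
  assumes "0 < \<tau>" "0 \<le> s" "1 \<le> n"
  shows "(1 - real n * s / ((real n + 1) * s + \<tau>)) * s = (s + \<tau>) * (real n * s / ((real n + 1) * s + \<tau>)) / real n"
proof -
  have "0 < (real n + 1) * s + \<tau>"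
    using assms by (intro add_nonneg_pos mult_nonneg_nonneg) auto
  then have ne: "(real n + 1) * s + \<tau> \<noteq> 0"
    by simp
  have "1 - real n * s / ((real n + 1) * s + \<tau>) = (s + \<tau>) / ((real n + 1) * s + \<tau>)"
    using ne by (simp add: eq_divide_eq diff_divide_distrib[symmetric] left_diff_distrib) (simp add: algebra_simps)
  then show ?thesis
    using assms by simp
qed

text \<open>A basis vector splits into its projection \<open>y\<close> and the rest
  \<open>z\<close>, eigenvectors of the training second moment (possibly zero). The normal equation
  for each row thereby falls into two scalar equations, solved by the two gains.\<close>

lemma effective_matrix_optimal:
  fixes U :: "real ^ 'q ^ 'd"
  assumes U: "orthonormal_columns U" and T: "symmetric_task_law T (mean_task_cov \<epsilon> U)"
    and \<epsilon>: "0 < \<epsilon>" and n: "1 \<le> n" and opt: "optimal_weights \<sigma> T n W"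
  defines "\<tau> \<equiv> real CARD('q) / 2 + \<epsilon> * real CARD('d) + \<sigma>\<^sup>2"
  shows "effective_matrix W = shrinkage (span_gain \<tau> \<epsilon> n) (complement_gain \<tau> \<epsilon> n) (U ** transpose U)"
proof (rule moment_risk_minimizer_unique)
  let ?S = "mean_task_cov \<epsilon> U" and ?P = "U ** transpose U"
  interpret attention_data \<sigma> T ?S n
    using T n by unfold_locales
  have \<tau>: "trace ?S + \<sigma>\<^sup>2 = \<tau>"
    by (simp add: trace_mean_task_cov[OF U] \<tau>_def)
  have pos: "0 < \<tau>"
    using \<epsilon> by (simp add: \<tau>_def add_pos_nonneg)
  show "transpose ?S = ?S"
    by (simp add: mean_task_cov_def transpose_add transpose_scalar matrix_transpose_mul)
  show "0 \<le> v \<bullet> (?S *v v)" for v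
    using \<epsilon> by (simp add: mean_task_cov_mult inner_add_right inner_transpose_mult)
  show "1 \<le> n"
    by fact
  show "0 < trace ?S + \<sigma>\<^sup>2"
    using pos by (simp add: \<tau>)
  show "moment_risk \<sigma> ?S n (effective_matrix W) \<le>
      moment_risk \<sigma> ?S n (shrinkage (span_gain \<tau> \<epsilon> n) (complement_gain \<tau> \<epsilon> n) ?P)"
    by (rule optimal_weightsD(2)[OF opt])
  fix a :: 'd
  define \<alpha> where "\<alpha> = span_gain \<tau> \<epsilon> n"
  define \<beta> where "\<beta> = complement_gain \<tau> \<epsilon> n"
  define y where "y = ?P *v axis a 1"
  define z where "z = axis a 1 - y"
  have "?P *v y = y"
    unfolding y_def
    by (intro projection_span[OF U]) (simp only: matrix_vector_mult_in_columnspace flip: matrix_vector_mul_assoc)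
  then have Sy: "?S *v y = (1/2 + \<epsilon>) *\<^sub>R y" and Sz: "?S *v z = \<epsilon> *\<^sub>R z"
    by (simp_all add: mean_task_cov_mult z_def matrix_vector_mult_diff_distrib scaleR_add_left scaleR_diff_right flip: y_def)
  have \<alpha>: "(1 - \<alpha>) * (1/2 + \<epsilon>) = ((1/2 + \<epsilon>) + \<tau>) * \<alpha> / real n"
    unfolding \<alpha>_def span_gain_def using pos \<epsilon> n by (intro shrinkage_gain_equation) auto
  have \<beta>: "(1 - \<beta>) * \<epsilon> = (\<epsilon> + \<tau>) * \<beta> / real n"
    unfolding \<beta>_def complement_gain_def using pos \<epsilon> n by (intro shrinkage_gain_equation) auto
  have row: "shrinkage \<alpha> \<beta> ?P $ a = \<alpha> *\<^sub>R y + \<beta> *\<^sub>R z"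
    by (simp add: shrinkage_def y_def z_def)
  have "axis a 1 - (\<alpha> *\<^sub>R y + \<beta> *\<^sub>R z) = (1 - \<alpha>) *\<^sub>R y + (1 - \<beta>) *\<^sub>R z"
    by (simp add: z_def algebra_simps)
  then have "?S *v (axis a 1 - (\<alpha> *\<^sub>R y + \<beta> *\<^sub>R z)) =
      ((1 - \<alpha>) * (1/2 + \<epsilon>)) *\<^sub>R y + ((1 - \<beta>) * \<epsilon>) *\<^sub>R z"
    by (simp only: matrix_vector_right_distrib matrix_vector_mult_scaleR Sy Sz scaleR_scaleR)
  also have "\<dots> = (1 / real n) *\<^sub>R (?S *v (\<alpha> *\<^sub>R y + \<beta> *\<^sub>R z) + \<tau> *\<^sub>R (\<alpha> *\<^sub>R y + \<beta> *\<^sub>R z))"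
    unfolding \<alpha> \<beta>
    by (simp only: matrix_vector_right_distrib matrix_vector_mult_scaleR Sy Sz scaleR_scaleR)
      (simp add: vec_eq_iff add_divide_distrib algebra_simps)
  finally show "?S *v (axis a 1 - shrinkage (span_gain \<tau> \<epsilon> n) (complement_gain \<tau> \<epsilon> n) ?P $ a) =
      (1 / real n) *\<^sub>R (?S *v (shrinkage (span_gain \<tau> \<epsilon> n) (complement_gain \<tau> \<epsilon> n) ?P $ a) +
        (trace ?S + \<sigma>\<^sup>2) *\<^sub>R shrinkage (span_gain \<tau> \<epsilon> n) (complement_gain \<tau> \<epsilon> n) ?P $ a)"
    unfolding \<alpha>_def[symmetric] \<beta>_def[symmetric] row \<tau> .
qed

text \<open>Transfer from training to test. Since \<epsilon> > 0 the training second moment is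
  positive definite, so the even residual vanishes also on test prompts, and only the effective
  matrix found in training enters the test risk.\<close>

lemma risk_optimal_weights:
  fixes U :: "real ^ 'q ^ 'd" and V :: "real ^ 'k ^ 'd"
  assumes U: "orthonormal_columns U" and T: "symmetric_task_law T (mean_task_cov \<epsilon> U)"
    and \<epsilon>: "0 < \<epsilon>" and n: "1 \<le> n" and opt: "optimal_weights \<sigma> T n W" and d: "2 \<le> CARD('d)"
    and V: "orthonormal_columns V" and m: "1 \<le> m"
  defines "\<tau> \<equiv> real CARD('q) / 2 + \<epsilon> * real CARD('d) + \<sigma>\<^sup>2"
  shows "risk \<sigma> (normal_vec (task_cov \<epsilon> V)) m W =
    moment_risk \<sigma> (task_cov \<epsilon> V) m (shrinkage (span_gain \<tau> \<epsilon> n) (complement_gain \<tau> \<epsilon> n) (U ** transpose U))"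
proof -
  interpret train: attention_data \<sigma> T "mean_task_cov \<epsilon> U" n
    using T n by unfold_locales
  interpret test: attention_data \<sigma> "normal_vec (task_cov \<epsilon> V)" "task_cov \<epsilon> V" m
    using \<epsilon> m V by unfold_locales (auto intro!: symmetric_task_law_normal_vec is_psd_root_task_cov)
  have "0 < e \<bullet> (mean_task_cov \<epsilon> U *v e)" if "e \<noteq> 0" for e
    using that \<epsilon> by (simp add: mean_task_cov_mult inner_add_right inner_transpose_mult add_nonneg_pos)
  then have "even_residual W m x w \<xi> = 0" for x w \<xi>
    by (intro train.even_residual_eq_0[OF train.optimal_weightsD(1)[OF opt] _ d]) (metis less_irrefl)
  then have "test.even_risk W = 0"
    by (simp add: test.even_risk_def)
  then show ?thesis
    using effective_matrix_optimal[OF U T \<epsilon> n opt] by (simp add: test.risk_eq \<tau>_def)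
qed

lemma tendsto_shrinkage:
  assumes "(\<alpha> \<longlongrightarrow> \<alpha>0) F" "(\<beta> \<longlongrightarrow> \<beta>0) F"
  shows "((\<lambda>x. shrinkage (\<alpha> x) (\<beta> x) P) \<longlongrightarrow> shrinkage \<alpha>0 \<beta>0 P) F"
  unfolding shrinkage_def by (intro tendsto_intros tendsto_vec_lambda assms)

lemma orthonormal_columns_rotation:
  fixes U V :: "real ^ 'q ^ 'd"
  assumes U: "orthonormal_columns U" and V: "orthonormal_columns V" and UV: "transpose U ** V = 0"
  shows "orthonormal_columns (cos \<theta> *\<^sub>R U + sin \<theta> *\<^sub>R V)"
proof -
  note VU = transpose_mult_eq_0_commute[OF UV]
  have mv: "transpose A *v (B *v v) = (transpose A ** B) *v v" for A B :: "real ^ 'q ^ 'd" and v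
    by (simp only: matrix_vector_mul_assoc)
  have "(transpose (cos \<theta> *\<^sub>R U + sin \<theta> *\<^sub>R V) ** (cos \<theta> *\<^sub>R U + sin \<theta> *\<^sub>R V)) *v v = v" for v
  proof -
    have "(transpose (cos \<theta> *\<^sub>R U + sin \<theta> *\<^sub>R V) ** (cos \<theta> *\<^sub>R U + sin \<theta> *\<^sub>R V)) *v v =
        (cos \<theta> * cos \<theta>) *\<^sub>R ((transpose U ** U) *v v) + (cos \<theta> * sin \<theta>) *\<^sub>R ((transpose U ** V) *v v) +
        (sin \<theta> * cos \<theta>) *\<^sub>R ((transpose V ** U) *v v) + (sin \<theta> * sin \<theta>) *\<^sub>R ((transpose V ** V) *v v)"
      unfolding matrix_vector_mul_assoc[symmetric] transpose_add transpose_scalar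
        matrix_vector_mult_add_rdistrib matrix_vector_right_distrib
        scaleR_matrix_vector_assoc[symmetric] matrix_vector_mult_scaleR
      by (simp only: scaleR_scaleR scaleR_add_right add_ac mult_ac)
    also have "\<dots> = v"
      using U V by (simp add: UV VU orthonormal_columns_def flip: scaleR_add_left)
    finally show ?thesis .
  qed
  then show ?thesis
    by (simp add: orthonormal_columns_def matrix_eq)
qed

text \<open>The complement of the span annihilates U, and V is orthogonal to the span, so only the
  sine part of W meets the unlearned directions. The sum is therefore (sin \<theta>)^2 times the
  trace of the projection given by V.\<close>

lemma residual_energy_rotation:
  fixes U V :: "real ^ 'q ^ 'd" and \<theta> :: real
  assumes U: "orthonormal_columns U" and V: "orthonormal_columns V" and UV: "transpose U ** V = 0"
  defines "W \<equiv> cos \<theta> *\<^sub>R U + sin \<theta> *\<^sub>R V"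
  shows "(\<Sum>a\<in>UNIV. (axis a 1 - (U ** transpose U) *v axis a 1) \<bullet>
      (task_cov 0 W *v (axis a 1 - (U ** transpose U) *v axis a 1))) = real CARD('q) * (sin \<theta>)\<^sup>2"
proof -
  note VU = transpose_mult_eq_0_commute[OF UV]
  have proj: "transpose W *v (v - (U ** transpose U) *v v) = sin \<theta> *\<^sub>R (transpose V *v v)" for v
  proof -
    have "transpose U *v ((U ** transpose U) *v v) = (transpose U ** U) *v (transpose U *v v)"
      "transpose V *v ((U ** transpose U) *v v) = (transpose V ** U) *v (transpose U *v v)"
      by (simp_all only: matrix_vector_mul_assoc matrix_mul_assoc)
    then have U0: "transpose U *v ((U ** transpose U) *v v) = transpose U *v v"
      and V0: "transpose V *v ((U ** transpose U) *v v) = 0"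
      using U by (simp_all add: VU orthonormal_columns_def)
    have "transpose W *v u = cos \<theta> *\<^sub>R (transpose U *v u) + sin \<theta> *\<^sub>R (transpose V *v u)" for u
      unfolding W_def transpose_add transpose_scalar matrix_vector_mult_add_rdistrib
        scaleR_matrix_vector_assoc[symmetric] ..
    then show ?thesis
      by (simp only: matrix_vector_mult_diff_distrib U0 V0) simp
  qed
  have "(\<Sum>a\<in>UNIV. (axis a 1 - (U ** transpose U) *v axis a 1) \<bullet>
      (task_cov 0 W *v (axis a 1 - (U ** transpose U) *v axis a 1))) =
      (\<Sum>a\<in>UNIV. (sin \<theta>)\<^sup>2 * (axis a 1 \<bullet> ((V ** transpose V) *v axis a 1)))"
    by (simp only: task_cov_mult scaleR_zero_left add_0_right inner_transpose_mult proj)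
      (simp add: power2_eq_square mult.assoc)
  then show ?thesis
    using trace_projection[OF V] by (simp add: trace_eq_sum_inner flip: sum_distrib_left)
qed

text \<open>\<open>W\<close> is an arbitrary selection of minimizers. The inner limits are named by
  \<open>L1\<close> and \<open>L2\<close>, so that their existence is part of the claim; the bounds
  exclude the empty prompt, for which the normalization 1 / 0 has the default value 0.\<close>

theorem theorem3:
  fixes U1 U2 :: "real ^ 'r ^ 'd"
    and Us Uperp Ut :: "real ^ 'q ^ 'd"
    and \<sigma> \<theta> :: real
    and W :: "real \<Rightarrow> nat \<Rightarrow> 'd weights"
  assumes "CARD('q) = 2 * CARD('r)"
    and "CARD('d) \<ge> 2 * CARD('q)"
    and "\<sigma> \<ge> 0"
    and "orthonormal_columns U1" and "orthonormal_columns U2"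
    and "transpose U1 ** U2 = 0"
    and "orthonormal_columns Us"
    and "span (columns Us) = {u + v | u v. u \<in> span (columns U1) \<and> v \<in> span (columns U2)}"
    and "orthonormal_columns Uperp"
    and "transpose Us ** Uperp = 0"
    and "0 \<le> \<theta>" and "\<theta> \<le> pi / 2"
    and "Ut = cos \<theta> *\<^sub>R Us + sin \<theta> *\<^sub>R Uperp"
    and "\<And>\<epsilon> n. \<epsilon> > 0 \<Longrightarrow> n \<ge> 1 \<Longrightarrow> optimal_weights \<sigma> (mixture_task_law \<epsilon> U1 U2) n (W \<epsilon> n)"
  shows "\<exists>(L1 :: nat \<Rightarrow> nat \<Rightarrow> real) (L2 :: nat \<Rightarrow> real).
    (\<forall>m\<ge>1. \<forall>n\<ge>1.
       ((\<lambda>\<epsilon>. risk \<sigma> (normal_vec (task_cov \<epsilon> Ut)) m (W \<epsilon> n)) \<longlongrightarrow> L1 m n) (at_right 0)) \<and>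
    (\<forall>m\<ge>1. L1 m \<longlonglongrightarrow> L2 m) \<and>
    L2 \<longlonglongrightarrow> real CARD('q) * (sin \<theta>)\<^sup>2 + \<sigma>\<^sup>2"
proof -
  let ?P = "Us ** transpose Us"
  have d: "2 \<le> CARD('d)"
    using assms(2) zero_less_card_finite[where 'a = 'q] by linarith
  have Ut: "orthonormal_columns Ut"
    unfolding assms(13) by (rule orthonormal_columns_rotation[OF assms(7,9,10)])
  have sum: "U1 ** transpose U1 + U2 ** transpose U2 = ?P"
    by (rule projection_sum_eq[OF assms(4-8)])
  define \<tau> where "\<tau> \<epsilon> = real CARD('q) / 2 + \<epsilon> * real CARD('d) + \<sigma>\<^sup>2" for \<epsilon>
  have \<tau>0: "0 < \<tau> 0"
    by (simp add: \<tau>_def add_pos_nonneg)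
  define L1 where "L1 m n = moment_risk \<sigma> (task_cov 0 Ut) m (shrinkage (span_gain (\<tau> 0) 0 n) 0 ?P)" for m n
  define L2 where "L2 m = moment_risk \<sigma> (task_cov 0 Ut) m (shrinkage 1 0 ?P)" for m
  have "((\<lambda>\<epsilon>. risk \<sigma> (normal_vec (task_cov \<epsilon> Ut)) m (W \<epsilon> n)) \<longlongrightarrow> L1 m n) (at_right 0)"
    if "1 \<le> m" "1 \<le> n" for m n
  proof -
    have id: "((\<lambda>\<epsilon>. \<epsilon>) \<longlongrightarrow> 0) (at_right (0 :: real))"
      by (rule tendsto_ident_at)
    have \<tau>_lim: "(\<tau> \<longlongrightarrow> \<tau> 0) (at_right 0)"
      unfolding \<tau>_def[abs_def] by (intro tendsto_intros id)
    have "((\<lambda>\<epsilon>. span_gain (\<tau> \<epsilon>) \<epsilon> n) \<longlongrightarrow> span_gain (\<tau> 0) 0 n) (at_right 0)"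
      unfolding span_gain_def using \<tau>0 by (intro tendsto_intros id \<tau>_lim) (simp add: add_pos_pos less_imp_neq[symmetric])
    moreover have "((\<lambda>\<epsilon>. complement_gain (\<tau> \<epsilon>) \<epsilon> n) \<longlongrightarrow> complement_gain (\<tau> 0) 0 n) (at_right 0)"
      unfolding complement_gain_def using \<tau>0 by (intro tendsto_intros id \<tau>_lim) simp
    then have "((\<lambda>\<epsilon>. complement_gain (\<tau> \<epsilon>) \<epsilon> n) \<longlongrightarrow> 0) (at_right 0)"
      by (simp add: complement_gain_def)
    moreover have "((\<lambda>\<epsilon>. task_cov \<epsilon> Ut) \<longlongrightarrow> task_cov 0 Ut) (at_right 0)"
      unfolding task_cov_def by (intro tendsto_intros id)
    ultimately have "((\<lambda>\<epsilon>. moment_risk \<sigma> (task_cov \<epsilon> Ut) m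
        (shrinkage (span_gain (\<tau> \<epsilon>) \<epsilon> n) (complement_gain (\<tau> \<epsilon>) \<epsilon> n) ?P)) \<longlongrightarrow> L1 m n) (at_right 0)"
      unfolding L1_def by (intro tendsto_moment_risk tendsto_shrinkage)
    \<comment> \<open>The closed form describes the risk only for \<epsilon> > 0, where
      \<open>W \<epsilon> n\<close> is optimal; this holds eventually in \<open>at_right 0\<close>,
      which suffices for the limit.\<close>
    moreover have "\<forall>\<^sub>F \<epsilon> in at_right 0. moment_risk \<sigma> (task_cov \<epsilon> Ut) m
        (shrinkage (span_gain (\<tau> \<epsilon>) \<epsilon> n) (complement_gain (\<tau> \<epsilon>) \<epsilon> n) ?P) =
        risk \<sigma> (normal_vec (task_cov \<epsilon> Ut)) m (W \<epsilon> n)"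
      using eventually_at_right_less[of 0]
    proof eventually_elim
      case (elim \<epsilon>)
      then have "symmetric_task_law (mixture_task_law \<epsilon> U1 U2) (mean_task_cov \<epsilon> Us)"
        by (intro symmetric_mixture_task_law assms sum) simp
      then show ?case
        unfolding \<tau>_def
        by (rule risk_optimal_weights[OF assms(7) _ elim that(2) assms(14)[OF elim that(2)] d Ut that(1), symmetric])
    qed
    ultimately show ?thesis
      by (rule Lim_transform_eventually)
  qed
  moreover have "L1 m \<longlonglongrightarrow> L2 m" for m
  proof -
    \<comment> \<open>This is \<open>span_gain (\<tau> 0) 0 n\<close> with numerator and denominator
      divided by n, so that n enters only through 1 / n.\<close>
    have "(\<lambda>n. (1/2) / (1/2 + (1/2 + \<tau> 0) * (1 / real n))) \<longlonglongrightarrow> (1/2) / (1/2 + (1/2 + \<tau> 0) * 0)"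
      by (intro tendsto_intros lim_1_over_n) simp
    moreover have "\<forall>\<^sub>F n in sequentially. (1/2) / (1/2 + (1/2 + \<tau> 0) * (1 / real n)) = span_gain (\<tau> 0) 0 n"
      using eventually_gt_at_top[of 0]
    proof eventually_elim
      case (elim n)
      then have "(1/2) / (1/2 + (1/2 + \<tau> 0) * (1 / real n)) =
          (real n * (1/2)) / (real n * (1/2 + (1/2 + \<tau> 0) * (1 / real n)))"
        by simp
      also have "real n * (1/2 + (1/2 + \<tau> 0) * (1 / real n)) = (real n + 1) * (1/2) + \<tau> 0"
        using elim by (simp add: field_simps)
      finally show ?case
        by (simp only: span_gain_def add_0_right)
    qed
    ultimately have "(\<lambda>n. span_gain (\<tau> 0) 0 n) \<longlonglongrightarrow> 1"
      by (simp add: Lim_transform_eventually)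
    then show ?thesis
      unfolding L1_def[abs_def] L2_def by (intro tendsto_moment_risk tendsto_shrinkage tendsto_const)
  qed
  moreover have "L2 \<longlonglongrightarrow> real CARD('q) * (sin \<theta>)\<^sup>2 + \<sigma>\<^sup>2"
    using moment_risk_tendsto_infinite_prompt[of \<sigma> "task_cov 0 Ut" "shrinkage 1 0 ?P"]
      residual_energy_rotation[OF assms(7,9,10), of \<theta>]
    by (simp add: L2_def[abs_def] shrinkage_def assms(13) add.commute)
  ultimately show ?thesis
    by blast
qed

end
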